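(* Let $H$ be a complex Hilbert space, let $m\in\mathbb{Z}_{1}$ and let $S\in\mathbf{B}(\ell^{2}(\mathbb{N},H))$ be an $m$-isometric unilateral weighted shift with positive and invertible weights $(S_{j})_{j\in\mathbb{Z}_{1}}\subset\mathbf{B}(H)$. The following conditions are equivalent: (i) all weights of $S$ commute (with each other); (ii) $S_{1},\ldots,S_{m-1}$ commute; (iii) if $p(z)=A_{m-1}z^{m-1}+\ldots+A_{1}z+I\in\mathbf{B}(H)_{m-1}[z]$ is a polynomial such that $p(n)=\lvert S_{n}\cdots S_{1}\rvert^{2}$ for every $n\in\mathbb{Z}_{1}$, then $A_{m-1},\ldots,A_{1}$ commute.
   Context: $\mathbb{N}$ is the set of non-negative integers and $\mathbb{Z}_{p}=\{n\in\mathbb{Z}: n\ge p\}$. $\mathbf{B}(H)$ is the algebra of bounded linear operators on a complex Hilbert space $H$; invertible means invertible in $\mathbf{B}(H)$; $\lvert T\rvert=(T^{*}T)^{1/2}$. An operator $T\in\mathbf{B}(H)$ is called positive if $\langle Tf,f\rangle>0$ for every $f\in H$, $f\neq 0$. $\ell^{2}(\mathbb{N},H)$ is the Hilbert space of square-summable sequences $(h_{i})_{i\in\mathbb{N}}$ in $H$. For a uniformly bounded sequence $(S_{i})_{i\in\mathbb{Z}_{1}}\subset\mathbf{B}(H)$, the unilateral weighted shift $S$ with weights $(S_{i})_{i\in\mathbb{Z}_{1}}$ is the bounded operator on $\ell^{2}(\mathbb{N},H)$ given by $S(h_{0},h_{1},\ldots)=(0,S_{1}h_{0},S_{2}h_{1},\ldots)$.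 A bounded operator $T$ is $m$-isometric ($m\in\mathbb{Z}_{1}$) if $\sum_{k=0}^{m}\binom{m}{k}(-1)^{m-k}T^{*k}T^{k}=0$. $\mathbf{B}(H)_{n}[z]$ denotes the space of polynomials $p(z)=\sum_{j=0}^{n}A_{j}z^{j}$ with coefficients $A_{j}\in\mathbf{B}(H)$ (degree at most $n$), evaluated at scalars $z\in\mathbb{C}$. *)

theory Defs
  imports "HOL-Analysis.Analysis"
begin

section \<open>Complex Hilbert spaces\<close>

text \<open>
  The inner product is linear in its first argument. The axiom \<open>cinner_self\<close> says that the norm
  is the one induced by the inner product; positivity and definiteness of \<open>cinner\<close> follow from
  those of the norm. The zero space is an admissible instance.
\<close>

class complex_inner_space = real_normed_vector +
  fixes scaleC :: "complex \<Rightarrow> 'a \<Rightarrow> 'a"  (infixr "*\<^sub>C" 75)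
    and cinner :: "'a \<Rightarrow> 'a \<Rightarrow> complex"
  assumes scaleC_add_right: "c *\<^sub>C (x + y) = c *\<^sub>C x + c *\<^sub>C y"
    and scaleC_add_left: "(c + d) *\<^sub>C x = c *\<^sub>C x + d *\<^sub>C x"
    and scaleC_scaleC: "c *\<^sub>C d *\<^sub>C x = (c * d) *\<^sub>C x"
    and scaleC_of_real: "complex_of_real r *\<^sub>C x = r *\<^sub>R x"
    and cinner_commute: "cinner x y = cnj (cinner y x)"
    and cinner_add_left: "cinner (x + y) z = cinner x z + cinner y z"
    and cinner_scaleC_left: "cinner (c *\<^sub>C x) y = c * cinner x y"
    and cinner_self: "cinner x x = complex_of_real ((norm x)\<^sup>2)"

class complex_hilbert_space = complex_inner_space + complete_space

subclass (in complex_hilbert_space) banach ..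

lemma scaleC_one: "1 *\<^sub>C (x :: 'a::complex_inner_space) = x"
  using scaleC_of_real[of 1 x] by simp

lemma cinner_add_right:
  "cinner x (y + z :: 'a::complex_inner_space) = cinner x y + cinner x z"
  by (metis cinner_add_left cinner_commute complex_cnj_add)

lemma cinner_scaleC_right:
  "cinner x (c *\<^sub>C y :: 'a::complex_inner_space) = cnj c * cinner x y"
  by (metis cinner_scaleC_left cinner_commute complex_cnj_mult)

lemma norm_scaleC: "norm (c *\<^sub>C x :: 'a::complex_inner_space) = cmod c * norm x"
proof -
  have "complex_of_real ((norm (c *\<^sub>C x))\<^sup>2) = c * cnj c * complex_of_real ((norm x)\<^sup>2)"
    by (simp only: cinner_self[symmetric] cinner_scaleC_left cinner_scaleC_right ac_simps)
  also have "\<dots> = complex_of_real ((cmod c * norm x)\<^sup>2)"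
    by (simp add: complex_mult_cnj cmod_power2 power_mult_distrib)
  finally have "(norm (c *\<^sub>C x))\<^sup>2 = (cmod c * norm x)\<^sup>2"
    using of_real_eq_iff by blast
  then show ?thesis by (simp add: power2_eq_iff_nonneg)
qed

lemma cinner_polarization:
  fixes x y :: "'a::complex_inner_space"
  shows "cinner x y = (complex_of_real ((norm (x + y))\<^sup>2) - complex_of_real ((norm (x + (-1) *\<^sub>C y))\<^sup>2)
    + \<i> * complex_of_real ((norm (x + \<i> *\<^sub>C y))\<^sup>2)
    - \<i> * complex_of_real ((norm (x + (-\<i>) *\<^sub>C y))\<^sup>2)) / 4"
  unfolding cinner_self[symmetric]
  by (simp add: cinner_add_left cinner_add_right cinner_scaleC_left cinner_scaleC_right algebra_simps)


section \<open>The Hilbert space of square-summable sequences\<close>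

typedef (overloaded) 'a ell2 =
  "{f :: nat \<Rightarrow> 'a::complex_hilbert_space. summable (\<lambda>n. (norm (f n))\<^sup>2)}"
  morphisms seq_of Abs_ell2
  by (rule exI[of _ "\<lambda>_. 0"]) simp

setup_lifting type_definition_ell2

lemma summable_ell2: "summable (\<lambda>n. (norm (seq_of f n))\<^sup>2)"
  using seq_of[of f] by simp

lemma summable_sq_add:
  fixes f g :: "nat \<Rightarrow> 'a::real_normed_vector"
  assumes "summable (\<lambda>n. (norm (f n))\<^sup>2)" "summable (\<lambda>n. (norm (g n))\<^sup>2)"
  shows "summable (\<lambda>n. (norm (f n + g n))\<^sup>2)"
proof (rule summable_comparison_test')
  show "summable (\<lambda>n. 2 * (norm (f n))\<^sup>2 + 2 * (norm (g n))\<^sup>2)"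
    using assms by (intro summable_add summable_mult)
  fix n :: nat
  have "(norm (f n + g n))\<^sup>2 \<le> (norm (f n) + norm (g n))\<^sup>2"
    by (intro power_mono norm_triangle_ineq) simp
  also have "\<dots> \<le> 2 * (norm (f n))\<^sup>2 + 2 * (norm (g n))\<^sup>2"
    using sum_squares_bound[of "norm (f n)" "norm (g n)"] by (simp add: power2_sum)
  finally show "norm ((norm (f n + g n))\<^sup>2) \<le> 2 * (norm (f n))\<^sup>2 + 2 * (norm (g n))\<^sup>2"
    by simp
qed

lemma summable_sq_scaleC:
  fixes f :: "nat \<Rightarrow> 'a::complex_inner_space"
  assumes "summable (\<lambda>n. (norm (f n))\<^sup>2)"
  shows "summable (\<lambda>n. (norm (c *\<^sub>C f n))\<^sup>2)"
  using assms by (simp add: norm_scaleC power_mult_distrib summable_mult)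

instantiation ell2 :: (complex_hilbert_space) real_normed_vector
begin

lift_definition zero_ell2 :: "'a ell2" is "\<lambda>_. 0" by simp

lift_definition uminus_ell2 :: "'a ell2 \<Rightarrow> 'a ell2" is "\<lambda>f n. - f n" by simp

lift_definition plus_ell2 :: "'a ell2 \<Rightarrow> 'a ell2 \<Rightarrow> 'a ell2" is "\<lambda>f g n. f n + g n"
  by (rule summable_sq_add)

lift_definition minus_ell2 :: "'a ell2 \<Rightarrow> 'a ell2 \<Rightarrow> 'a ell2" is "\<lambda>f g n. f n - g n"
  using summable_sq_add[of _ "\<lambda>n. - _ n"] by simp

lift_definition scaleR_ell2 :: "real \<Rightarrow> 'a ell2 \<Rightarrow> 'a ell2" is "\<lambda>r f n. r *\<^sub>R f n"
  by (simp add: power_mult_distrib summable_mult)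

definition norm_ell2 :: "'a ell2 \<Rightarrow> real" where
  "norm_ell2 f = sqrt (\<Sum>n. (norm (seq_of f n))\<^sup>2)"

definition dist_ell2 :: "'a ell2 \<Rightarrow> 'a ell2 \<Rightarrow> real" where
  "dist_ell2 f g = norm (f - g)"

definition sgn_ell2 :: "'a ell2 \<Rightarrow> 'a ell2" where
  "sgn_ell2 f = inverse (norm f) *\<^sub>R f"

definition uniformity_ell2 :: "('a ell2 \<times> 'a ell2) filter" where
  "uniformity_ell2 = (INF e\<in>{0<..}. principal {(x, y). dist x y < e})"

definition open_ell2 :: "'a ell2 set \<Rightarrow> bool" where
  "open_ell2 U \<longleftrightarrow> (\<forall>x\<in>U. eventually (\<lambda>(x', y). x' = x \<longrightarrow> y \<in> U) uniformity)"

instance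
proof
  fix f g h :: "'a ell2" and r s :: real and U :: "'a ell2 set"
  have norm_sq: "(norm f)\<^sup>2 = (\<Sum>n. (norm (seq_of f n))\<^sup>2)" for f :: "'a ell2"
    by (simp add: norm_ell2_def suminf_nonneg summable_ell2)
  have partial_le: "L2_set (\<lambda>n. norm (seq_of f n)) {..<k} \<le> norm f" for f :: "'a ell2" and k
    unfolding L2_set_def norm_ell2_def
    by (intro real_sqrt_le_mono sum_le_suminf summable_ell2) auto
  show "f + g + h = f + (g + h)" by transfer (simp add: add.assoc)
  show "f + g = g + f" by transfer (simp add: add.commute)
  show "0 + f = f" by transfer simp
  show "- f + f = 0" by transfer simp
  show "f - g = f + - g" by transfer simp
  show "r *\<^sub>R (f + g) = r *\<^sub>R f + r *\<^sub>R g" by transfer (simp add: scaleR_add_right)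
  show "(r + s) *\<^sub>R f = r *\<^sub>R f + s *\<^sub>R f" by transfer (simp add: scaleR_add_left)
  show "r *\<^sub>R s *\<^sub>R f = (r * s) *\<^sub>R f" by transfer simp
  show "1 *\<^sub>R f = f" by transfer simp
  show "dist f g = norm (f - g)" by (fact dist_ell2_def)
  show "sgn f = inverse (norm f) *\<^sub>R f" by (rule sgn_ell2_def)
  show "uniformity = (INF e\<in>{0<..}. principal {(x :: 'a ell2, y). dist x y < e})"
    by (fact uniformity_ell2_def)
  show "open U \<longleftrightarrow> (\<forall>x\<in>U. \<forall>\<^sub>F (x', y) in uniformity. x' = x \<longrightarrow> y \<in> U)"
    by (fact open_ell2_def)
  show "norm f = 0 \<longleftrightarrow> f = 0"
  proof -
    have "norm f = 0 \<longleftrightarrow> (\<forall>n. (norm (seq_of f n))\<^sup>2 = 0)"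
      unfolding norm_ell2_def using suminf_eq_zero_iff[OF summable_ell2[of f]] by simp
    also have "\<dots> \<longleftrightarrow> f = 0" by transfer auto
    finally show ?thesis .
  qed
  show "norm (f + g) \<le> norm f + norm g"
  proof -
    have "(\<Sum>n<k. (norm (seq_of (f + g) n))\<^sup>2) \<le> (norm f + norm g)\<^sup>2" for k
    proof -
      have "L2_set (\<lambda>n. norm (seq_of (f + g) n)) {..<k}
          \<le> L2_set (\<lambda>n. norm (seq_of f n) + norm (seq_of g n)) {..<k}"
        by (intro L2_set_mono) (auto simp: plus_ell2.rep_eq norm_triangle_ineq)
      also have "\<dots> \<le> norm f + norm g"
        by (rule order_trans[OF L2_set_triangle_ineq add_mono[OF partial_le partial_le]])
      finally show ?thesis unfolding L2_set_def by (rule sqrt_le_D)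
    qed
    then have "(\<Sum>n. (norm (seq_of (f + g) n))\<^sup>2) \<le> (norm f + norm g)\<^sup>2"
      by (intro suminf_le_const summable_ell2)
    moreover have "0 \<le> norm f + norm g"
      by (simp add: norm_ell2_def suminf_nonneg summable_ell2)
    ultimately show ?thesis
      unfolding norm_sq[symmetric] by (rule power2_le_imp_le)
  qed
  show "norm (r *\<^sub>R f) = \<bar>r\<bar> * norm f"
    by (simp add: norm_ell2_def scaleR_ell2.rep_eq power_mult_distrib suminf_mult summable_ell2
        real_sqrt_mult)
qed

end

lemma norm_ell2_sq: "(norm f)\<^sup>2 = (\<Sum>n. (norm (seq_of f n))\<^sup>2)"
  by (simp add: norm_ell2_def suminf_nonneg summable_ell2)

lemma summ_cinner: "summable (\<lambda>n. cinner (seq_of f n) (seq_of g n))"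
proof -
  have *: "summable (\<lambda>n. complex_of_real ((norm (seq_of f n + c *\<^sub>C seq_of g n))\<^sup>2))" for c
    by (intro summable_of_real summable_sq_add summable_sq_scaleC summable_ell2)
  show ?thesis
    unfolding cinner_polarization
    using *[of 1] *[of "-1"] *[of "\<i>"] *[of "-\<i>"]
    by (intro summable_divide summable_diff summable_add summable_mult) (simp_all add: scaleC_one)
qed

instantiation ell2 :: (complex_hilbert_space) complex_inner_space
begin

lift_definition scaleC_ell2 :: "complex \<Rightarrow> 'a ell2 \<Rightarrow> 'a ell2" is "\<lambda>c f n. c *\<^sub>C f n"
  by (rule summable_sq_scaleC)

definition cinner_ell2 :: "'a ell2 \<Rightarrow> 'a ell2 \<Rightarrow> complex" where
  "cinner_ell2 f g = (\<Sum>n. cinner (seq_of f n) (seq_of g n))"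

instance
proof
  fix f g h :: "'a ell2" and r :: real and c d :: complex
  show "c *\<^sub>C (f + g) = c *\<^sub>C f + c *\<^sub>C g" by transfer (simp add: scaleC_add_right)
  show "(c + d) *\<^sub>C f = c *\<^sub>C f + d *\<^sub>C f" by transfer (simp add: scaleC_add_left)
  show "c *\<^sub>C d *\<^sub>C f = (c * d) *\<^sub>C f" by transfer (simp add: scaleC_scaleC)
  show "complex_of_real r *\<^sub>C f = r *\<^sub>R f" by transfer (simp add: scaleC_of_real)
  show "cinner f g = cnj (cinner g f)"
    unfolding cinner_ell2_def
    by (subst cinner_commute)
      (metis (no_types, lifting) sums_cnj summ_cinner summable_sums sums_unique suminf_cong)
  show "cinner (f + g) h = cinner f h + cinner g h"
    by (simp add: cinner_ell2_def plus_ell2.rep_eq cinner_add_left suminf_add summ_cinner)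
  show "cinner (c *\<^sub>C f) g = c * cinner f g"
    by (simp add: cinner_ell2_def scaleC_ell2.rep_eq cinner_scaleC_left suminf_mult summ_cinner)
  show "cinner f f = complex_of_real ((norm f)\<^sup>2)"
    unfolding norm_ell2_sq by (simp add: cinner_ell2_def cinner_self suminf_of_real summable_ell2)
qed

end

lemma sum_le_norm_ell2: "(\<Sum>n<k. (norm (seq_of f n))\<^sup>2) \<le> (norm f)\<^sup>2"
  unfolding norm_ell2_sq by (intro sum_le_suminf summable_ell2) auto

lemma norm_seq_of_le: "norm (seq_of f n) \<le> norm f"
proof (rule power2_le_imp_le)
  have "(norm (seq_of f n))\<^sup>2 \<le> (\<Sum>i<Suc n. (norm (seq_of f i))\<^sup>2)"
    by (simp add: sum_nonneg)
  then show "(norm (seq_of f n))\<^sup>2 \<le> (norm f)\<^sup>2"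
    using sum_le_norm_ell2 order_trans by blast
qed simp

instance ell2 :: (complex_hilbert_space) complex_hilbert_space
proof
  fix X :: "nat \<Rightarrow> 'a ell2"
  assume X: "Cauchy X"
  have "Cauchy (\<lambda>n. seq_of (X n) i)" for i
  proof (rule CauchyI)
    fix e :: real assume "0 < e"
    then obtain N where N: "\<forall>m\<ge>N. \<forall>n\<ge>N. norm (X m - X n) < e"
      using CauchyD[OF X] by blast
    have "norm (seq_of (X m) i - seq_of (X n) i) \<le> norm (X m - X n)" for m n
      using norm_seq_of_le[of "X m - X n" i] by (simp add: minus_ell2.rep_eq)
    then show "\<exists>N. \<forall>m\<ge>N. \<forall>n\<ge>N. norm (seq_of (X m) i - seq_of (X n) i) < e"
      using N order_le_less_trans by blast
  qed
  then have "\<exists>l. (\<lambda>n. seq_of (X n) i) \<longlonglongrightarrow> l" for i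
    by (simp add: Cauchy_convergent_iff convergent_def)
  then obtain L where L: "\<And>i. (\<lambda>n. seq_of (X n) i) \<longlonglongrightarrow> L i" by metis
  have bound: "\<exists>N. \<forall>n\<ge>N. \<forall>k. (\<Sum>i<k. (norm (seq_of (X n) i - L i))\<^sup>2) \<le> e\<^sup>2" if "0 < e" for e
  proof -
    obtain N where N: "\<forall>m\<ge>N. \<forall>n\<ge>N. norm (X m - X n) < e"
      using CauchyD[OF X] \<open>0 < e\<close> by blast
    have "(\<Sum>i<k. (norm (seq_of (X n) i - L i))\<^sup>2) \<le> e\<^sup>2" if "n \<ge> N" for n k
    proof (rule LIMSEQ_le_const2)
      show "(\<lambda>m. \<Sum>i<k. (norm (seq_of (X n) i - seq_of (X m) i))\<^sup>2)
          \<longlonglongrightarrow> (\<Sum>i<k. (norm (seq_of (X n) i - L i))\<^sup>2)"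
        by (intro tendsto_intros L)
      have "(\<Sum>i<k. (norm (seq_of (X n) i - seq_of (X m) i))\<^sup>2) \<le> e\<^sup>2" if "m \<ge> N" for m
      proof -
        have "(\<Sum>i<k. (norm (seq_of (X n - X m) i))\<^sup>2) \<le> (norm (X n - X m))\<^sup>2"
          by (rule sum_le_norm_ell2)
        also have "\<dots> \<le> e\<^sup>2"
          using N \<open>n \<ge> N\<close> that by (intro power_mono) (auto intro: less_imp_le)
        finally show ?thesis by (simp add: minus_ell2.rep_eq)
      qed
      then show "\<exists>M. \<forall>m\<ge>M. (\<Sum>i<k. (norm (seq_of (X n) i - seq_of (X m) i))\<^sup>2) \<le> e\<^sup>2"
        by blast
    qed
    then show ?thesis by blast
  qed
  have summ: "summable (\<lambda>i. (norm (d i))\<^sup>2)"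
    if "\<And>k. (\<Sum>i<k. (norm (d i))\<^sup>2) \<le> e\<^sup>2" for d :: "nat \<Rightarrow> 'a" and e :: real
    using that by (intro summableI_nonneg_bounded) auto
  obtain N1 where N1: "\<And>k. (\<Sum>i<k. (norm (seq_of (X N1) i - L i))\<^sup>2) \<le> 1\<^sup>2"
    using bound[OF zero_less_one] by blast
  have "summable (\<lambda>i. (norm (- (seq_of (X N1) i - L i)))\<^sup>2)"
    using summ[OF N1] by (simp only: norm_minus_cancel)
  from summable_sq_add[OF this summable_ell2[of "X N1"]]
  have "summable (\<lambda>i. (norm (L i))\<^sup>2)" by simp
  then have seq: "seq_of (Abs_ell2 L) = L" by (simp add: Abs_ell2_inverse)
  have "X \<longlonglongrightarrow> Abs_ell2 L"
  proof (rule LIMSEQ_I)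
    fix r :: real assume "0 < r"
    then obtain N where N: "\<forall>n\<ge>N. \<forall>k. (\<Sum>i<k. (norm (seq_of (X n) i - L i))\<^sup>2) \<le> (r / 2)\<^sup>2"
      using bound[of "r / 2"] by (meson half_gt_zero)
    have "norm (X n - Abs_ell2 L) < r" if "n \<ge> N" for n
    proof -
      have "(norm (X n - Abs_ell2 L))\<^sup>2 \<le> (r / 2)\<^sup>2"
        unfolding norm_ell2_sq
      proof (rule suminf_le_const[OF summable_ell2])
        show "(\<Sum>i<k. (norm (seq_of (X n - Abs_ell2 L) i))\<^sup>2) \<le> (r / 2)\<^sup>2" for k
          using N[rule_format, OF that, of k] by (simp only: minus_ell2.rep_eq seq)
      qed
      then have "norm (X n - Abs_ell2 L) \<le> r / 2"
        by (rule power2_le_imp_le) (use \<open>0 < r\<close> in simp)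
      then show ?thesis using \<open>0 < r\<close> by simp
    qed
    then show "\<exists>N. \<forall>n\<ge>N. norm (X n - Abs_ell2 L) < r" by blast
  qed
  then show "convergent X" by (auto simp: convergent_def)
qed


section \<open>Bounded operators\<close>

text \<open>Elements of \<open>B(H)\<close> are the functions satisfying \<open>bounded_clinear\<close>; the product of
  operators is \<open>\<circ>\<close>, powers are \<open>^^\<close>, and \<open>id\<close> is the identity operator.\<close>

definition bounded_clinear :: "('a::complex_inner_space \<Rightarrow> 'b::complex_inner_space) \<Rightarrow> bool" where
  "bounded_clinear T \<longleftrightarrow> bounded_linear T \<and> (\<forall>c x. T (c *\<^sub>C x) = c *\<^sub>C T x)"

text \<open>On a Hilbert space a bounded operator has exactly one adjoint.\<close>

definition cadjoint :: "('a::complex_hilbert_space \<Rightarrow> 'a) \<Rightarrow> 'a \<Rightarrow> 'a" where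
  "cadjoint T = (THE T'. bounded_clinear T' \<and> (\<forall>x y. cinner (T x) y = cinner x (T' y)))"

definition invertible_op :: "('a::complex_hilbert_space \<Rightarrow> 'a) \<Rightarrow> bool" where
  "invertible_op T \<longleftrightarrow>
    bounded_clinear T \<and> (\<exists>T'. bounded_clinear T' \<and> T \<circ> T' = id \<and> T' \<circ> T = id)"

definition positive_op :: "('a::complex_hilbert_space \<Rightarrow> 'a) \<Rightarrow> bool" where
  "positive_op T \<longleftrightarrow>
    bounded_clinear T \<and> (\<forall>f. f \<noteq> 0 \<longrightarrow> cinner (T f) f \<in> \<real> \<and> Re (cinner (T f) f) > 0)"

definition nonneg_op :: "('a::complex_hilbert_space \<Rightarrow> 'a) \<Rightarrow> bool" where
  "nonneg_op T \<longleftrightarrow>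
    bounded_clinear T \<and> (\<forall>f. cinner (T f) f \<in> \<real> \<and> Re (cinner (T f) f) \<ge> 0)"

text \<open>Every nonnegative operator has exactly one nonnegative square root.\<close>

definition sqrt_op :: "('a::complex_hilbert_space \<Rightarrow> 'a) \<Rightarrow> 'a \<Rightarrow> 'a" where
  "sqrt_op A = (THE B. nonneg_op B \<and> B \<circ> B = A)"

definition modulus_op :: "('a::complex_hilbert_space \<Rightarrow> 'a) \<Rightarrow> 'a \<Rightarrow> 'a" where
  "modulus_op T = sqrt_op (cadjoint T \<circ> T)"

definition m_isometric :: "nat \<Rightarrow> ('a::complex_hilbert_space \<Rightarrow> 'a) \<Rightarrow> bool" where
  "m_isometric m T \<longleftrightarrow> bounded_clinear T \<and>
    (\<forall>x. (\<Sum>k\<le>m. (real (m choose k) * (-1) ^ (m - k)) *\<^sub>R (cadjoint T ^^ k) ((T ^^ k) x)) = 0)"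

definition commuting_family :: "'i set \<Rightarrow> ('i \<Rightarrow> 'a \<Rightarrow> 'a) \<Rightarrow> bool" where
  "commuting_family I F \<longleftrightarrow> (\<forall>i\<in>I. \<forall>j\<in>I. F i \<circ> F j = F j \<circ> F i)"

text \<open>The value at \<open>z\<close> of the polynomial of degree at most \<open>n\<close> with coefficients \<open>A 0, \<dots>, A n\<close>.\<close>

definition op_poly ::
    "nat \<Rightarrow> (nat \<Rightarrow> 'a::complex_hilbert_space \<Rightarrow> 'a) \<Rightarrow> complex \<Rightarrow> 'a \<Rightarrow> 'a" where
  "op_poly n A z = (\<lambda>x. \<Sum>j\<le>n. (z ^ j) *\<^sub>C A j x)"


section \<open>Unilateral weighted shifts\<close>

text \<open>The weights are \<open>W 1, W 2, \<dots>\<close>; the value \<open>W 0\<close> is never used.\<close>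

definition weighted_shift ::
    "(nat \<Rightarrow> 'a::complex_hilbert_space \<Rightarrow> 'a) \<Rightarrow> ('a ell2 \<Rightarrow> 'a ell2) \<Rightarrow> bool" where
  "weighted_shift W S \<longleftrightarrow>
    (\<forall>j\<ge>1. bounded_clinear (W j)) \<and> (\<exists>M. \<forall>j\<ge>1. onorm (W j) \<le> M) \<and>
    (\<forall>h. seq_of (S h) 0 = 0 \<and> (\<forall>i. seq_of (S h) (Suc i) = W (Suc i) (seq_of h i)))"

text \<open>\<open>weight_prod W n\<close> is the product \<open>W n \<circ> \<dots> \<circ> W 1\<close>.\<close>

fun weight_prod :: "(nat \<Rightarrow> 'a \<Rightarrow> 'a) \<Rightarrow> nat \<Rightarrow> 'a \<Rightarrow> 'a" where
  "weight_prod W 0 = id"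
| "weight_prod W (Suc n) = W (Suc n) \<circ> weight_prod W n"

end

(*
  Put P n = W n ... W 1 and Q n = |P n|^2. Testing the m-isometry identity on sequences with one
  nonzero entry shows that the m-th differences of Q vanish, so Newton's formula turns Q into an
  operator polynomial of degree less than m. Its coefficients and its first m values are linear
  combinations of each other, hence one family commutes iff the other does, iff all Q n commute.
  If the first m - 1 weights commute, so do the first m values of Q. Conversely, since
  Q (n + 1) = P(n)^* W(n + 1)^2 P(n), an operator commuting with all Q n commutes inductively with
  each W(n + 1)^2, hence with its positive root W(n + 1).
*)

theory Submission
  imports Defs
begin

section \<open>Bounded operators on complex inner product spaces\<close>

text \<open>Two facts that functional calculus would supply carry the argument: commuting with W^2
  forces commuting with W, and |P|^2 really is the adjoint of P times P, although the modulus is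
  defined by a definite description of a square root. Invertibility makes every weight and every Q n
  coercive. For coercive B and C the equation B X = - X C has only the solution X = 0; with X = B T
  - T B this yields commutation with roots, with X = B - C uniqueness of roots. Existence of the
  root is a fixed point argument. Condition (iii) quantifies over all polynomials with the
  prescribed values, so using it requires that one exists, which is what Newton's formula provides;
  in the other direction the infinitely many integer points force commutators of coefficients to
  vanish.\<close>

lemma bounded_clinearD:
  assumes "bounded_clinear T"
  shows "bounded_linear T" "T (c *\<^sub>C x) = c *\<^sub>C T x" "T (x + y) = T x + T y"
    "T (x - y) = T x - T y" "T (r *\<^sub>R x) = r *\<^sub>R T x" "T 0 = 0" "T (- x) = - T x"
    "T (sum f I) = (\<Sum>i\<in>I. T (f i))"
  using assms
  by (auto simp: bounded_clinear_def linear_simps linear_0 linear_sum bounded_linear.linear)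

lemma bounded_clinear_id: "bounded_clinear id"
  unfolding bounded_clinear_def id_def by (simp add: bounded_linear_ident)

lemma bounded_clinear_compose:
  assumes "bounded_clinear T" "bounded_clinear U"
  shows "bounded_clinear (T \<circ> U)"
  using assms unfolding bounded_clinear_def o_def by (auto intro: bounded_linear_compose)

lemma scaleC_zero_right [simp]: "c *\<^sub>C (0 :: 'a::complex_inner_space) = 0"
  using scaleC_add_right[of c 0 "0::'a"] by simp

lemma scaleC_minus_right: "c *\<^sub>C (- x :: 'a::complex_inner_space) = - (c *\<^sub>C x)"
  using scaleC_add_right[of c x "-x"] by (simp add: eq_neg_iff_add_eq_0 add.commute)

lemma scaleC_diff_right: "c *\<^sub>C (x - y :: 'a::complex_inner_space) = c *\<^sub>C x - c *\<^sub>C y"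
  using scaleC_add_right[of c x "-y"] by (simp add: scaleC_minus_right)

lemma scaleC_zero_left [simp]: "0 *\<^sub>C (x :: 'a::complex_inner_space) = 0"
  using scaleC_of_real[of 0 x] by simp

lemma scaleC_scaleR_commute: "c *\<^sub>C r *\<^sub>R (x :: 'a::complex_inner_space) = r *\<^sub>R c *\<^sub>C x"
  by (simp add: scaleC_scaleC mult.commute flip: scaleC_of_real)

lemma bounded_linear_scaleC: "bounded_linear (\<lambda>x::'a::complex_inner_space. c *\<^sub>C x)"
  by (rule bounded_linear_intro[of _ "cmod c"])
    (simp_all add: scaleC_add_right scaleC_scaleR_commute norm_scaleC)

lemma scaleC_sum_right: "c *\<^sub>C (sum f I :: 'a::complex_inner_space) = (\<Sum>i\<in>I. c *\<^sub>C f i)"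
  using linear_sum[OF bounded_linear.linear[OF bounded_linear_scaleC]] by blast

lemma scaleC_sum_left: "sum c I *\<^sub>C (x :: 'a::complex_inner_space) = (\<Sum>i\<in>I. c i *\<^sub>C x)"
  by (induction I rule: infinite_finite_induct) (simp_all add: scaleC_add_left)

lemma bounded_clinear_scaleC:
  assumes "bounded_clinear T"
  shows "bounded_clinear (\<lambda>x. c *\<^sub>C T x)"
  using assms bounded_linear_compose[OF bounded_linear_scaleC[of c]]
  unfolding bounded_clinear_def by (auto simp: scaleC_scaleC mult.commute)

lemma bounded_clinear_scaleR:
  assumes "bounded_clinear T"
  shows "bounded_clinear (\<lambda>x. r *\<^sub>R T x)"
  using bounded_clinear_scaleC[OF assms, of "complex_of_real r"] by (simp add: scaleC_of_real)

lemma bounded_clinear_diff: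
  assumes "bounded_clinear T" "bounded_clinear U"
  shows "bounded_clinear (\<lambda>x. T x - U x)"
  using assms unfolding bounded_clinear_def by (auto intro: bounded_linear_sub simp: scaleC_diff_right)

lemma bounded_clinear_sum:
  assumes "\<And>i. i \<in> I \<Longrightarrow> bounded_clinear (T i)"
  shows "bounded_clinear (\<lambda>x. \<Sum>i\<in>I. T i x)"
  using assms unfolding bounded_clinear_def by (auto intro: bounded_linear_sum simp: scaleC_sum_right)

lemma cinner_scaleR_left: "cinner (r *\<^sub>R x) (y :: 'a::complex_inner_space) = of_real r * cinner x y"
  by (metis cinner_scaleC_left scaleC_of_real)

lemma cinner_scaleR_right: "cinner x (r *\<^sub>R y :: 'a::complex_inner_space) = of_real r * cinner x y"
  by (metis cinner_scaleC_right complex_cnj_complex_of_real scaleC_of_real)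

lemma cinner_zero_left [simp]: "cinner 0 (y :: 'a::complex_inner_space) = 0"
  using cinner_scaleR_left[of 0 y y] by simp

lemma cinner_zero_right [simp]: "cinner x (0 :: 'a::complex_inner_space) = 0"
  using cinner_scaleR_right[of x 0 x] by simp

lemma cinner_diff_left: "cinner (x - y) (z :: 'a::complex_inner_space) = cinner x z - cinner y z"
  using cinner_add_left[of "x - y" y z] by simp

lemma cinner_diff_right: "cinner x (y - z :: 'a::complex_inner_space) = cinner x y - cinner x z"
  using cinner_add_right[of x "y - z" z] by simp

lemma cinner_sum_left: "cinner (sum f I) (y :: 'a::complex_inner_space) = (\<Sum>i\<in>I. cinner (f i) y)"
  by (induction I rule: infinite_finite_induct) (simp_all add: cinner_add_left)

lemma cinner_sum_right: "cinner x (sum f I :: 'a::complex_inner_space) = (\<Sum>i\<in>I. cinner x (f i))"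
  by (induction I rule: infinite_finite_induct) (simp_all add: cinner_add_right)

lemmas cinner_expand = cinner_add_left cinner_add_right cinner_diff_left cinner_diff_right
  cinner_scaleC_left cinner_scaleC_right cinner_scaleR_left cinner_scaleR_right

lemma Re_cinner_commute: "Re (cinner x (y :: 'a::complex_inner_space)) = Re (cinner y x)"
  by (subst cinner_commute) simp

lemma Re_cinner_self: "Re (cinner x (x :: 'a::complex_inner_space)) = (norm x)\<^sup>2"
  by (simp add: cinner_self)

lemma norm_add_sq: "(norm (x + y :: 'a::complex_inner_space))\<^sup>2
    = (norm x)\<^sup>2 + 2 * Re (cinner x y) + (norm y)\<^sup>2"
  using Re_cinner_commute[of x y]
  by (simp add: cinner_add_left cinner_add_right flip: Re_cinner_self)

lemma norm_diff_sq: "(norm (x - y :: 'a::complex_inner_space))\<^sup>2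
    = (norm x)\<^sup>2 - 2 * Re (cinner x y) + (norm y)\<^sup>2"
  using Re_cinner_commute[of x y]
  by (simp add: cinner_diff_left cinner_diff_right flip: Re_cinner_self)

lemma Re_cinner_le: "Re (cinner x (y :: 'a::complex_inner_space)) \<le> norm x * norm y"
proof -
  have "(norm (x + y))\<^sup>2 \<le> (norm x + norm y)\<^sup>2"
    by (intro power_mono norm_triangle_ineq) simp
  then show ?thesis by (simp add: norm_add_sq power2_sum)
qed

lemma abs_Re_cinner_le: "\<bar>Re (cinner x (y :: 'a::complex_inner_space))\<bar> \<le> norm x * norm y"
  using Re_cinner_le[of x y] Re_cinner_le[of "-x" y] cinner_diff_left[of 0 x y] by simp

lemma bounded_linear_Re_cinner: "bounded_linear (\<lambda>x. Re (cinner x (y :: 'a::complex_inner_space)))"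
  by (rule bounded_linear_intro[of _ "norm y"])
    (simp_all add: cinner_add_left cinner_scaleR_left abs_Re_cinner_le)

lemma eq_if_cinner_eq:
  fixes x y :: "'a::complex_inner_space"
  assumes "\<And>z. cinner z x = cinner z y"
  shows "x = y"
proof -
  have "cinner (x - y) (x - y) = 0"
    using assms by (simp add: cinner_diff_right)
  then show ?thesis by (simp add: cinner_self)
qed

text \<open>Im (cinner u y) is Re (cinner u (\<i> y)), so the imaginary part is the real hypothesis
  taken at \<i> y.\<close>

lemma Re_selfadjoint_imp_selfadjoint:
  assumes "bounded_clinear T" and sym: "\<And>x y. Re (cinner (T x) y) = Re (cinner x (T y))"
  shows "cinner (T x) y = cinner x (T y)"
proof (rule complex_eqI)
  show "Im (cinner (T x) y) = Im (cinner x (T y))"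
    using sym[of x "\<i> *\<^sub>C y"]
    by (simp add: bounded_clinearD(2)[OF assms(1)] cinner_scaleC_right)
qed (rule sym)

text \<open>Polarization with complex scalars: the imaginary part of the form at x + \<i> y isolates
  the antisymmetric part of Re (cinner (T x) y).\<close>

lemma selfadjoint_if_real:
  assumes T: "bounded_clinear T" and real: "\<And>f. cinner (T f) f \<in> \<real>"
  shows "cinner (T x) y = cinner x (T y)"
proof (rule Re_selfadjoint_imp_selfadjoint[OF T])
  fix x y
  have im: "Im (cinner (T f) f) = 0" for f
    using real[of f] by (simp add: complex_is_Real_iff)
  have "Im (cinner (T (x + \<i> *\<^sub>C y)) (x + \<i> *\<^sub>C y)) = Re (cinner (T y) x) - Re (cinner (T x) y)"
    using im[of x] im[of y]
    by (simp add: bounded_clinearD[OF T] cinner_expand)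
  then show "Re (cinner (T x) y) = Re (cinner x (T y))"
    using im[of "x + \<i> *\<^sub>C y"] Re_cinner_commute[of x "T y"] by simp
qed

text \<open>At x + T x the symmetric cross terms add up to 2 |T x|^2, while the form vanishes at x
  and at T x.\<close>

lemma zero_if_quadratic_form_zero:
  assumes T: "bounded_clinear T" and zero: "\<And>f. Re (cinner (T f) f) = 0"
    and sym: "\<And>x y. cinner (T x) y = cinner x (T y)"
  shows "T x = 0"
proof -
  have "Re (cinner (T (x + T x)) (x + T x)) = 2 * (norm (T x))\<^sup>2"
    using zero[of x] zero[of "T x"] sym[of "T x" x]
    by (simp add: bounded_clinearD[OF T] cinner_expand Re_cinner_self)
  then show ?thesis using zero by simp
qed

text \<open>\<open>cadjoint\<close> is a definite description, so one operator satisfying the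
  adjoint relation pins it down; uniqueness is nondegeneracy of the inner product.\<close>

lemma cadjoint_eqI:
  assumes "bounded_clinear T'" "\<And>x y. cinner (T x) y = cinner x (T' y)"
  shows "cadjoint T = T'"
  unfolding cadjoint_def
proof (rule the_equality)
  fix U assume "bounded_clinear U \<and> (\<forall>x y. cinner (T x) y = cinner x (U y))"
  then show "U = T'"
    using assms(2) by (intro ext eq_if_cinner_eq) metis
qed (use assms in auto)


section \<open>Coercive operators and their square roots\<close>

definition coercive :: "('a::complex_inner_space \<Rightarrow> 'a) \<Rightarrow> bool" where
  "coercive T \<longleftrightarrow> bounded_clinear T \<and> (\<exists>d>0. \<forall>x. d * (norm x)\<^sup>2 \<le> Re (cinner (T x) x))"

text \<open>In the expanded square the cross term is at least 2 c d |y|^2, hence s c = sqrt (c^2 + 2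
  c d). \<open>s\<close> is a function because c is fixed only later, by the other operator in
  \<open>sylvester_zero\<close>.\<close>

lemma coercive_shift_bound:
  assumes "coercive B"
  obtains s where "\<And>c. c > 0 \<Longrightarrow> s c > c" "\<And>c y. c > 0 \<Longrightarrow> s c * norm y \<le> norm (c *\<^sub>R y + B y)"
proof -
  obtain d where d: "d > 0" "\<And>x. d * (norm x)\<^sup>2 \<le> Re (cinner (B x) x)"
    using assms by (auto simp: coercive_def)
  have "c < sqrt (c\<^sup>2 + 2 * c * d)" if "c > 0" for c
    using that d(1) by (intro real_less_rsqrt) simp
  moreover have "sqrt (c\<^sup>2 + 2 * c * d) * norm y \<le> norm (c *\<^sub>R y + B y)" if "c > 0" for c y
  proof (rule power2_le_imp_le)
    have "2 * c * (d * (norm y)\<^sup>2) \<le> 2 * c * Re (cinner (B y) y)"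
      using that d(2)[of y] by (intro mult_left_mono) auto
    moreover have "(norm (c *\<^sub>R y + B y))\<^sup>2
        = c\<^sup>2 * (norm y)\<^sup>2 + 2 * c * Re (cinner (B y) y) + (norm (B y))\<^sup>2"
      using Re_cinner_commute[of y "B y"]
      by (simp add: norm_add_sq cinner_scaleR_left power_mult_distrib)
    moreover have "(sqrt (c\<^sup>2 + 2 * c * d) * norm y)\<^sup>2 = c\<^sup>2 * (norm y)\<^sup>2 + 2 * c * (d * (norm y)\<^sup>2)"
      using that d(1) by (simp add: power_mult_distrib distrib_right)
    ultimately show "(sqrt (c\<^sup>2 + 2 * c * d) * norm y)\<^sup>2 \<le> (norm (c *\<^sub>R y + B y))\<^sup>2"
      using zero_le_power2[of "norm (B y)"] by linarith
  qed simp
  ultimately show thesis by (rule that[of "\<lambda>c. sqrt (c\<^sup>2 + 2 * c * d)"])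
qed

text \<open>For large c the cross term, linear in c, outweighs the fixed term |C x|^2. The bound
  serves both the Sylvester argument and the rescaling before the square root is
  constructed.\<close>

lemma coercive_contraction_bound:
  assumes "coercive C"
  obtains c q where "c > 0" "0 \<le> q" "q < 1" "\<And>x. norm (c *\<^sub>R x - C x) \<le> c * q * norm x"
proof -
  obtain d where d: "d > 0" "\<And>x. d * (norm x)\<^sup>2 \<le> Re (cinner (C x) x)"
    and C: "bounded_linear C"
    using assms by (auto simp: coercive_def bounded_clinear_def)
  obtain K where K: "K > 0" "\<And>x. norm (C x) \<le> norm x * K"
    using bounded_linear.pos_bounded[OF C] by blast
  \<comment> \<open>The summand K^2 / d gives K^2 \<le> d c, so that c^2 - 2 c d + K^2 is at most
    c^2 - c d = (c q)^2; the summand d keeps 1 - d / c nonnegative.\<close>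
  define c where "c = K\<^sup>2 / d + d"
  have c: "c > 0" "K\<^sup>2 \<le> d * c" "d \<le> c"
    using d K by (auto simp: c_def field_simps intro: add_nonneg_pos)
  define q where "q = sqrt (1 - d / c)"
  have q: "0 \<le> q" "q < 1" "q\<^sup>2 = 1 - d / c"
    using c d by (auto simp: q_def)
  have "norm (c *\<^sub>R x - C x) \<le> c * q * norm x" for x
  proof (rule power2_le_imp_le)
    have "(norm (C x))\<^sup>2 \<le> d * c * (norm x)\<^sup>2"
    proof -
      have "(norm (C x))\<^sup>2 \<le> (norm x * K)\<^sup>2" by (intro power_mono K(2)) simp
      also have "\<dots> \<le> d * c * (norm x)\<^sup>2"
        using c(2) by (simp add: power_mult_distrib mult.commute mult_right_mono)
      finally show ?thesis .
    qed
    moreover have "c * (d * (norm x)\<^sup>2) \<le> c * Re (cinner (C x) x)"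
      using d(2)[of x] c by (intro mult_left_mono) auto
    moreover have "(c * q * norm x)\<^sup>2 = c\<^sup>2 * (norm x)\<^sup>2 - c * d * (norm x)\<^sup>2"
      unfolding power_mult_distrib q(3) using c(1) by (simp add: field_simps power2_eq_square)
    moreover have "(norm (c *\<^sub>R x - C x))\<^sup>2
        = c\<^sup>2 * (norm x)\<^sup>2 - 2 * c * Re (cinner (C x) x) + (norm (C x))\<^sup>2"
      using Re_cinner_commute[of x "C x"]
      by (simp add: norm_diff_sq cinner_scaleR_left power_mult_distrib)
    ultimately show "(norm (c *\<^sub>R x - C x))\<^sup>2 \<le> (c * q * norm x)\<^sup>2"
      by (simp add: algebra_simps)
  qed (use c q in auto)
  then show thesis using that c q by blast
qed

text \<open>The equation gives \<open>(c + B) X = X (c - C)\<close>; for large \<open>c\<close> the left factor expands norms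
  by more than \<open>c\<close> and the right one contracts them to less than \<open>c\<close>, so \<open>X\<close> has norm zero.\<close>

lemma sylvester_zero:
  assumes B: "coercive B" and C: "coercive C" and X: "bounded_linear X"
    and eq: "\<And>x. B (X x) = - X (C x)"
  shows "X x = 0"
proof -
  obtain c q where c: "c > 0" "0 \<le> q" "q < 1" "\<And>x. norm (c *\<^sub>R x - C x) \<le> c * q * norm x"
    using coercive_contraction_bound[OF C] by blast
  obtain s where "\<And>c. c > 0 \<Longrightarrow> s c > c" "\<And>c y. c > 0 \<Longrightarrow> s c * norm y \<le> norm (c *\<^sub>R y + B y)"
    using coercive_shift_bound[OF B] by blast
  then have s: "c < s c" "\<And>y. s c * norm y \<le> norm (c *\<^sub>R y + B y)" using c by auto
  have "norm (X x) \<le> (onorm X * c / s c) * norm x" for x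
  proof -
    have "s c * norm (X x) \<le> norm (X (c *\<^sub>R x - C x))"
      using s(2)[of "X x"] by (simp add: eq linear_simps[OF X])
    also have "\<dots> \<le> onorm X * (c * norm x)"
    proof (rule order_trans[OF onorm[OF X]], rule mult_left_mono)
      have "c * q * norm x \<le> c * 1 * norm x"
        using c by (intro mult_right_mono mult_left_mono) auto
      then show "norm (c *\<^sub>R x - C x) \<le> c * norm x"
        using c(4)[of x] by simp
    qed (rule onorm_pos_le[OF X])
    finally show ?thesis using s(1) c(1) by (simp add: field_simps)
  qed
  then have "onorm X \<le> onorm X * c / s c"
    using s(1) c(1) onorm_pos_le[OF X] by (intro onorm_bound) auto
  then have "onorm X * (s c - c) \<le> 0"
    using s(1) c(1) by (simp add: field_simps)
  then have "onorm X \<le> 0"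
    using s(1) by (simp add: mult_le_0_iff)
  then have "onorm X = 0" using onorm_pos_le[OF X] by linarith
  then show ?thesis using onorm_eq_0[OF X] by simp
qed

text \<open>The commutator X = B T - T B anticommutes with B: since T commutes with B^2, both B X
  and - X B equal B^2 T - B T B.\<close>

lemma commute_if_commute_square:
  assumes B: "coercive B" and T: "bounded_clinear T" and comm: "T \<circ> (B \<circ> B) = (B \<circ> B) \<circ> T"
  shows "T \<circ> B = B \<circ> T"
proof
  fix x
  have B': "bounded_clinear B" using B by (simp add: coercive_def)
  have "B (T x) - T (B x) = 0"
  proof (rule sylvester_zero[OF B B, where X = "\<lambda>x. B (T x) - T (B x)"])
    show "bounded_linear (\<lambda>x. B (T x) - T (B x))"
      using bounded_clinear_diff[OF bounded_clinear_compose[OF B' T] bounded_clinear_compose[OF T B']]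
      by (simp add: o_def bounded_clinear_def)
    show "B (B (T x) - T (B x)) = - (B (T (B x)) - T (B (B x)))" for x
      using fun_cong[OF comm, of x] by (simp add: bounded_clinearD[OF B'])
  qed
  then show "(T \<circ> B) x = (B \<circ> T) x" by simp
qed

text \<open>This is the operator inequality B^2 \<le> K B, obtained from nonnegativity of the form
  at x - B x / K.\<close>

lemma nonneg_op_norm_sq_le:
  assumes B: "nonneg_op B" and K: "K > 0" "\<And>x. norm (B x) \<le> norm x * K"
  shows "(norm (B x))\<^sup>2 \<le> K * Re (cinner (B x) x)"
proof -
  have B': "bounded_clinear B" and pos: "\<And>x. 0 \<le> Re (cinner (B x) x)"
    and sym: "\<And>x y. cinner (B x) y = cinner x (B y)"
    using B by (auto simp: nonneg_op_def intro: selfadjoint_if_real)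
  have "0 \<le> Re (cinner (B (x - (1 / K) *\<^sub>R B x)) (x - (1 / K) *\<^sub>R B x))"
    by (rule pos)
  also have "\<dots> = Re (cinner (B x) x) - 2 / K * (norm (B x))\<^sup>2
      + (1 / K)\<^sup>2 * Re (cinner (B (B x)) (B x))"
    using sym[of "B x" x]
    by (simp add: bounded_clinearD[OF B'] cinner_expand Re_cinner_self power2_eq_square right_diff_distrib)
  also have "Re (cinner (B (B x)) (B x)) \<le> K * (norm (B x))\<^sup>2"
    using order_trans[OF Re_cinner_le mult_right_mono[OF K(2) norm_ge_zero], of "B x" "B x"]
    by (simp add: power2_eq_square mult.commute mult.left_commute)
  finally have "0 \<le> Re (cinner (B x) x) - 2 / K * (norm (B x))\<^sup>2 + (1 / K)\<^sup>2 * (K * (norm (B x))\<^sup>2)"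
    by (simp add: mult_left_mono)
  then show ?thesis using K(1) by (simp add: field_simps power2_eq_square)
qed

text \<open>Converts a lower bound on norms, as a bounded inverse gives it, into one on the form:
  d^2 |x|^2 \<le> |B x|^2 \<le> K Re (cinner (B x) x).\<close>

lemma coercive_if_bounded_below:
  assumes B: "nonneg_op B" and d: "d > 0" "\<And>x. d * norm x \<le> norm (B x)"
  shows "coercive B"
proof -
  have B': "bounded_clinear B" using B by (simp add: nonneg_op_def)
  obtain K where K: "K > 0" "\<And>x. norm (B x) \<le> norm x * K"
    using bounded_linear.pos_bounded[OF bounded_clinearD(1)[OF B']] by blast
  have "d\<^sup>2 / K * (norm x)\<^sup>2 \<le> Re (cinner (B x) x)" for x
  proof -
    have "(d * norm x)\<^sup>2 \<le> (norm (B x))\<^sup>2"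
      using d by (intro power_mono) auto
    also have "\<dots> \<le> K * Re (cinner (B x) x)"
      by (rule nonneg_op_norm_sq_le[OF B K])
    finally show ?thesis using K(1) by (simp add: field_simps power_mult_distrib)
  qed
  then show ?thesis
    unfolding coercive_def using B' d(1) K(1) by (auto intro!: exI[of _ "d\<^sup>2 / K"])
qed

lemma coercive_norm_ge:
  assumes "coercive Q"
  obtains d where "d > 0" "\<And>x. d * norm x \<le> norm (Q x)"
proof -
  obtain d where d: "d > 0" "\<And>x. d * (norm x)\<^sup>2 \<le> Re (cinner (Q x) x)"
    using assms by (auto simp: coercive_def)
  have "d * norm x \<le> norm (Q x)" for x
  proof (cases "x = 0")
    case False
    have "d * norm x * norm x \<le> norm (Q x) * norm x"
      using order_trans[OF d(2) Re_cinner_le, of x] by (simp add: power2_eq_square)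
    then show ?thesis using False by simp
  qed simp
  then show thesis using that d by blast
qed

section \<open>Existence and uniqueness of the nonnegative square root\<close>

lemma coercive_square_root:
  assumes Q: "coercive Q" and B: "nonneg_op B" and sq: "B \<circ> B = Q"
  shows "coercive B"
proof -
  obtain d where d: "d > 0" "\<And>x. d * norm x \<le> norm (Q x)"
    using coercive_norm_ge[OF Q] by blast
  obtain K where K: "K > 0" "\<And>x. norm (B x) \<le> norm x * K"
    using bounded_linear.pos_bounded[OF bounded_clinearD(1)] B nonneg_op_def by blast
  have "d / K * norm x \<le> norm (B x)" for x
    using order_trans[OF d(2)[of x], of "norm (B x) * K"] K(1) K(2)[of "B x"] sq
    by (auto simp: field_simps)
  then show ?thesis
    using coercive_if_bounded_below[OF B, of "d / K"] d K by auto
qed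

text \<open>The two roots are not known to commute, so B^2 - C^2 cannot be factored. Instead X = B -
  C satisfies B X = Q - B C = - X C, a Sylvester equation.\<close>

lemma square_root_unique:
  assumes Q: "coercive Q" and B: "nonneg_op B" "B \<circ> B = Q" and C: "nonneg_op C" "C \<circ> C = Q"
  shows "B = C"
proof
  fix x
  have lin: "bounded_clinear B" "bounded_clinear C" using B C by (auto simp: nonneg_op_def)
  have "B x - C x = 0"
  proof (rule sylvester_zero[where X = "\<lambda>x. B x - C x"])
    show "coercive B" "coercive C" using coercive_square_root Q B C by blast+
    show "bounded_linear (\<lambda>x. B x - C x)"
      using lin by (intro bounded_linear_sub) (auto simp: bounded_clinear_def)
    show "B (B x - C x) = - (B (C x) - C (C x))" for x
      using fun_cong[OF B(2), of x] fun_cong[OF C(2), of x]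
      by (simp add: bounded_clinearD[OF lin(1)])
  qed
  then show "B x = C x" by simp
qed

text \<open>After rescaling, \<open>Q = 1 - X\<close> with \<open>X\<close> of norm less than one, and the square root is
  \<open>1 - Y\<close> where \<open>Y\<close> is the fixed point of the contraction \<open>Y \<mapsto> (X + Y\<^sup>2) / 2\<close>.\<close>

lemma square_root_exists:
  fixes Q :: "'a::complex_hilbert_space \<Rightarrow> 'a"
  assumes Q: "coercive Q" and sym: "\<And>x y. cinner (Q x) y = cinner x (Q y)"
  obtains B where "nonneg_op B" "B \<circ> B = Q"
proof -
  obtain c q where c: "c > 0" and q: "0 \<le> q" "q < 1"
    and bound: "\<And>x. norm (c *\<^sub>R x - Q x) \<le> c * q * norm x"
    using coercive_contraction_bound[OF Q] by blast
  have Q': "bounded_clinear Q" using Q by (simp add: coercive_def)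
  have "bounded_linear (\<lambda>x. x - (1 / c) *\<^sub>R Q x)"
    using bounded_clinear_diff[OF bounded_clinear_id bounded_clinear_scaleR[OF Q']]
    by (simp add: bounded_clinear_def)
  then obtain X where X: "\<And>x. blinfun_apply X x = x - (1 / c) *\<^sub>R Q x"
    using bounded_linear_Blinfun_apply by metis
  have normX: "norm X \<le> q"
  proof (rule norm_blinfun_bound)
    fix x
    have "norm (blinfun_apply X x) = norm ((1 / c) *\<^sub>R (c *\<^sub>R x - Q x))"
      using c by (simp add: X scaleR_diff_right)
    also have "\<dots> \<le> (1 / c) * (c * q * norm x)"
      unfolding norm_scaleR using c bound[of x] by (intro mult_mono) auto
    finally show "norm (blinfun_apply X x) \<le> q * norm x" using c by simp
  qed (rule q)
  define F where "F Y = (1 / 2) *\<^sub>R (X + (Y o\<^sub>L Y))" for Y :: "'a \<Rightarrow>\<^sub>L 'a"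
  \<comment> \<open>A closed set preserved by \<open>F\<close>. Elements of the
    \<open>blinfun\<close> type are only real-linear, so complex homogeneity is a separate clause;
    symmetry is phrased with real parts, which \<open>bounded_linear_Re_cinner\<close> makes a
    closed condition.\<close>
  define M where "M = {Y::'a \<Rightarrow>\<^sub>L 'a. norm Y \<le> q \<and> (\<forall>c x. blinfun_apply Y (c *\<^sub>C x) = c *\<^sub>C blinfun_apply Y x)
    \<and> (\<forall>x y. Re (cinner (blinfun_apply Y x) y) = Re (cinner (blinfun_apply Y y) x))}"
  have cont: "continuous_on UNIV (\<lambda>Y::'a \<Rightarrow>\<^sub>L 'a. blinfun_apply Y x)" for x
    by (intro continuous_intros)
  have "closed {Y::'a \<Rightarrow>\<^sub>L 'a. norm Y \<le> q}"
    by (intro closed_Collect_le continuous_intros)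
  moreover have "closed {Y::'a \<Rightarrow>\<^sub>L 'a. \<forall>c x. blinfun_apply Y (c *\<^sub>C x) = c *\<^sub>C blinfun_apply Y x}"
    by (intro closed_Collect_all closed_Collect_eq cont
        bounded_linear.continuous_on[OF bounded_linear_scaleC cont])
  moreover have "closed {Y::'a \<Rightarrow>\<^sub>L 'a.
      \<forall>x y. Re (cinner (blinfun_apply Y x) y) = Re (cinner (blinfun_apply Y y) x)}"
    by (intro closed_Collect_all closed_Collect_eq
        bounded_linear.continuous_on[OF bounded_linear_Re_cinner cont])
  ultimately have "closed M"
    unfolding M_def by (simp add: closed_Collect_conj)
  then have "complete M" by (simp add: complete_eq_closed)
  moreover have "0 \<in> M" using q by (simp add: M_def)
  then have "M \<noteq> {}" by blast
  moreover have "F ` M \<subseteq> M"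
  proof clarify
    fix Y assume Y: "Y \<in> M"
    have "norm (Y o\<^sub>L Y) \<le> q * q"
      using Y q by (intro order_trans[OF norm_blinfun_compose] mult_mono) (auto simp: M_def)
    then have "norm (X + (Y o\<^sub>L Y)) \<le> q + q * 1"
      using normX q mult_left_mono[of q 1 q] by (intro order_trans[OF norm_triangle_ineq] add_mono) auto
    then have "norm (F Y) \<le> q" by (simp add: F_def)
    moreover have "blinfun_apply (F Y) (c *\<^sub>C x) = c *\<^sub>C blinfun_apply (F Y) x" for c x
      using Y bounded_clinearD(2)[OF Q']
      by (simp add: F_def M_def X blinfun.add_left blinfun.scaleR_left scaleC_add_right
          scaleC_diff_right scaleC_scaleR_commute)
    moreover have "Re (cinner (blinfun_apply (F Y) x) y) = Re (cinner (blinfun_apply (F Y) y) x)" for x y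
    proof -
      have Y2: "Re (cinner (blinfun_apply Y (blinfun_apply Y x)) y)
          = Re (cinner (blinfun_apply Y (blinfun_apply Y y)) x)"
        using Y Re_cinner_commute[of "blinfun_apply Y x" "blinfun_apply Y y"] by (simp add: M_def)
      have "Re (cinner (Q x) y) = Re (cinner (Q y) x)"
        using sym[of x y] Re_cinner_commute[of x "Q y"] by simp
      then show ?thesis
        using Y2 Re_cinner_commute[of x y]
        by (simp add: F_def X blinfun.add_left blinfun.scaleR_left cinner_expand)
    qed
    ultimately show "F Y \<in> M" by (simp add: M_def)
  qed
  moreover have "\<forall>Y\<in>M. \<forall>Z\<in>M. dist (F Y) (F Z) \<le> q * dist Y Z"
  proof clarify
    fix Y Z assume YZ: "Y \<in> M" "Z \<in> M"
    \<comment> \<open>Y and Z need not commute, so Y^2 - Z^2 is split as Y (Y - Z) + (Y - Z) Z;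
      after halving, each summand contributes q / 2 to the contraction constant.\<close>
    have "F Y - F Z = (1 / 2) *\<^sub>R ((Y o\<^sub>L (Y - Z)) + ((Y - Z) o\<^sub>L Z))"
      by (rule blinfun_eqI) (simp add: F_def blinfun.add_left blinfun.scaleR_left blinfun.diff_left
          blinfun.diff_right flip: scaleR_diff_right)
    also have "norm \<dots> \<le> (1 / 2) * (norm Y * norm (Y - Z) + norm (Y - Z) * norm Z)"
      by (simp add: order_trans[OF norm_triangle_ineq add_mono] norm_blinfun_compose)
    also have "\<dots> \<le> (1 / 2) * (q * norm (Y - Z) + norm (Y - Z) * q)"
      using YZ by (intro mult_left_mono add_mono mult_mono) (auto simp: M_def q)
    finally show "dist (F Y) (F Z) \<le> q * dist Y Z" by (simp add: dist_norm)
  qed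
  ultimately obtain Y where Y: "Y \<in> M" and fix_Y: "F Y = Y"
    using Banach_fix[of M q F] q by blast
  define B where "B x = sqrt c *\<^sub>R (x - blinfun_apply Y x)" for x
  have "bounded_clinear (blinfun_apply Y)"
    using Y by (simp add: bounded_clinear_def M_def blinfun.bounded_linear_right)
  then have B': "bounded_clinear B"
    unfolding B_def using bounded_clinear_scaleR[OF bounded_clinear_diff[OF bounded_clinear_id]] by simp
  have "cinner (B x) y = cinner x (B y)" for x y
  proof (rule Re_selfadjoint_imp_selfadjoint[OF B'])
    show "Re (cinner (B x) y) = Re (cinner x (B y))" for x y
      using Y Re_cinner_commute[of x "blinfun_apply Y y"]
      by (simp add: M_def B_def cinner_expand)
  qed
  then have "cinner (B x) x \<in> \<real>" for x
    using cinner_commute[of "B x" x] by (simp add: complex_is_Real_iff complex_eq_iff)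
  moreover have "0 \<le> Re (cinner (B x) x)" for x
  proof -
    have "Re (cinner (blinfun_apply Y x) x) \<le> norm (blinfun_apply Y x) * norm x"
      by (rule Re_cinner_le)
    also have "\<dots> \<le> (q * norm x) * norm x"
      using Y order_trans[OF norm_blinfun mult_right_mono] by (intro mult_right_mono) (auto simp: M_def)
    also have "\<dots> \<le> (1 * norm x) * norm x"
      using q by (intro mult_right_mono) auto
    finally show ?thesis
      using c by (simp add: B_def cinner_expand cinner_self power2_eq_square)
  qed
  ultimately have "nonneg_op B" by (simp add: nonneg_op_def B')
  moreover have "B (B x) = Q x" for x
  proof -
    \<comment> \<open>The fixed point equation 2 Y = X + Y^2 says (1 - Y)^2 = 1 - X = Q / c, and the
      factor sqrt c in \<open>B\<close> undoes the rescaling.\<close>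
    have "2 *\<^sub>R blinfun_apply Y x = 2 *\<^sub>R blinfun_apply (F Y) x" by (simp only: fix_Y)
    then have "2 *\<^sub>R blinfun_apply Y x = x - (1 / c) *\<^sub>R Q x + blinfun_apply Y (blinfun_apply Y x)"
      by (simp add: F_def X blinfun.add_left blinfun.scaleR_left)
    then have "x - 2 *\<^sub>R blinfun_apply Y x + blinfun_apply Y (blinfun_apply Y x) = (1 / c) *\<^sub>R Q x"
      by (simp add: algebra_simps)
    moreover have "B (B x) = c *\<^sub>R (x - 2 *\<^sub>R blinfun_apply Y x + blinfun_apply Y (blinfun_apply Y x))"
    proof -
      have "B (B x) = (sqrt c * sqrt c) *\<^sub>R
          (x - blinfun_apply Y x - blinfun_apply Y (x - blinfun_apply Y x))"
        by (simp only: B_def blinfun.scaleR_right scaleR_scaleR flip: scaleR_diff_right)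
      then show ?thesis using c by (simp add: blinfun.diff_right scaleR_2 algebra_simps)
    qed
    ultimately show ?thesis using c by simp
  qed
  ultimately show thesis by (intro that[of B]) (simp_all add: fun_eq_iff)
qed

lemma sqrt_op_square:
  fixes Q :: "'a::complex_hilbert_space \<Rightarrow> 'a"
  assumes "coercive Q" "\<And>x y. cinner (Q x) y = cinner x (Q y)"
  shows "sqrt_op Q ^^ 2 = Q"
proof -
  obtain B where B: "nonneg_op B" "B \<circ> B = Q"
    using square_root_exists assms by blast
  have "sqrt_op Q = B"
    unfolding sqrt_op_def using B square_root_unique[OF assms(1)] by (intro the_equality) auto
  then show ?thesis using B by (simp add: numeral_2_eq_2)
qed


section \<open>Commutation\<close>

lemma commute_comp:
  assumes "T \<circ> U = U \<circ> T" "T \<circ> V = V \<circ> T"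
  shows "T \<circ> (U \<circ> V) = (U \<circ> V) \<circ> T"
  using assms by (metis comp_assoc)

lemma commute_weight_prod:
  assumes "\<And>i. i \<in> {1..n} \<Longrightarrow> T \<circ> W i = W i \<circ> T"
  shows "T \<circ> weight_prod W n = weight_prod W n \<circ> T"
  using assms
proof (induction n)
  case (Suc n)
  show ?case
    unfolding weight_prod.simps by (intro commute_comp Suc.IH Suc.prems) auto
qed simp

lemma commute_op_poly:
  assumes "bounded_clinear T" "\<And>j. j \<le> n \<Longrightarrow> T \<circ> A j = A j \<circ> T"
  shows "T \<circ> op_poly n A z = op_poly n A z \<circ> T"
  using assms(2) by (auto simp: op_poly_def bounded_clinearD[OF assms(1)] fun_eq_iff)

lemma op_poly_0: "op_poly n A 0 = A 0"
proof -
  have "(\<Sum>j\<le>n. (0 ^ j) *\<^sub>C A j x) = (\<Sum>j\<le>n. if j = 0 then A j x else 0)" for x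
    by (intro sum.cong) (auto simp: scaleC_one power_0_left)
  then show ?thesis by (simp add: op_poly_def)
qed

text \<open>A commutator with a coefficient is a coefficient of a polynomial that vanishes at every
  natural number.\<close>

lemma commute_coefficient:
  assumes T: "bounded_clinear T"
    and comm: "\<And>k::nat. T \<circ> op_poly n A (of_nat k) = op_poly n A (of_nat k) \<circ> T"
    and j: "j \<le> n"
  shows "T \<circ> A j = A j \<circ> T"
proof
  fix x
  \<comment> \<open>Pairing with the j-th commutator at x makes the polynomial scalar, with a
    squared norm as its j-th coefficient.\<close>
  define c where "c i = cinner (T (A i x) - A i (T x)) (T (A j x) - A j (T x))" for i
  have "(\<Sum>i\<le>n. c i * of_nat k ^ i) = 0" for k :: nat
  proof -
    have "(\<Sum>i\<le>n. (of_nat k ^ i) *\<^sub>C (T (A i x) - A i (T x))) = 0"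
      using fun_cong[OF comm[of k], of x]
      by (simp add: op_poly_def bounded_clinearD[OF T] scaleC_diff_right sum_subtractf)
    then have "0 = cinner (\<Sum>i\<le>n. (of_nat k ^ i) *\<^sub>C (T (A i x) - A i (T x))) (T (A j x) - A j (T x))"
      by simp
    then show ?thesis
      by (simp add: cinner_sum_left cinner_scaleC_left c_def mult.commute)
  qed
  then have "range of_nat \<subseteq> {z. (\<Sum>i\<le>n. c i * z ^ i) = 0}" by auto
  moreover have "infinite (range (of_nat :: nat \<Rightarrow> complex))"
    by (simp add: finite_image_iff inj_of_nat)
  ultimately have "infinite {z. (\<Sum>i\<le>n. c i * z ^ i) = 0}"
    using finite_subset by blast
  then have "c j = 0"
    using polyfun_finite_roots[of c n] j by blast
  then show "(T \<circ> A j) x = (A j \<circ> T) x"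
    by (simp add: c_def cinner_self)
qed


section \<open>Finite differences\<close>

fun fdiff :: "nat \<Rightarrow> (nat \<Rightarrow> 'a::real_vector) \<Rightarrow> nat \<Rightarrow> 'a" where
  "fdiff 0 u n = u n"
| "fdiff (Suc k) u n = fdiff k u (Suc n) - fdiff k u n"

text \<open>The exponent k + i has the parity of k - i and avoids truncated subtraction in the
  induction.\<close>

lemma fdiff_eq_sum:
  "fdiff k u n = (\<Sum>i\<le>k. (real (k choose i) * (-1) ^ (k + i)) *\<^sub>R u (n + i))"
proof (induction k arbitrary: n)
  case (Suc k)
  have "(\<Sum>i\<le>k. (real (k choose i) * (-1) ^ (k + i)) *\<^sub>R u (n + i))
      = (\<Sum>i\<le>Suc k. (real (k choose i) * (-1) ^ (k + i)) *\<^sub>R u (n + i))"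
    by (simp add: binomial_eq_0)
  also have "\<dots> = (-1) ^ k *\<^sub>R u n
      + (\<Sum>i\<le>k. (real (k choose Suc i) * (-1) ^ (k + Suc i)) *\<^sub>R u (n + Suc i))"
    by (subst sum.atMost_Suc_shift) simp
  finally show ?case
    unfolding fdiff.simps Suc sum.atMost_Suc_shift[of _ k]
    by (simp add: algebra_simps sum.distrib sum_negf)
qed simp

text \<open>Induction with a moving base point: the hypothesis at a + 1, the identity fdiff k u (a +
  1) = fdiff k u a + fdiff (k + 1) u a, and Pascal's rule.\<close>

lemma newton_expansion: "u (a + n) = (\<Sum>k\<le>n. real (n choose k) *\<^sub>R fdiff k u a)"
proof (induction n arbitrary: a)
  case (Suc n)
  have "u (a + Suc n) = (\<Sum>k\<le>n. real (n choose k) *\<^sub>R (fdiff k u a + fdiff (Suc k) u a))"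
    using Suc[of "Suc a"] by simp
  also have "\<dots> = (\<Sum>k\<le>n. real (n choose k) *\<^sub>R fdiff k u a)
      + (\<Sum>k\<le>n. real (n choose k) *\<^sub>R fdiff (Suc k) u a)"
    by (simp only: scaleR_add_right sum.distrib)
  also have "(\<Sum>k\<le>n. real (n choose k) *\<^sub>R fdiff k u a)
      = (\<Sum>k\<le>Suc n. real (n choose k) *\<^sub>R fdiff k u a)"
    by (simp add: binomial_eq_0)
  also have "\<dots> = fdiff 0 u a + (\<Sum>k\<le>n. real (n choose Suc k) *\<^sub>R fdiff (Suc k) u a)"
    by (subst sum.atMost_Suc_shift) simp
  finally show ?case
    unfolding sum.atMost_Suc_shift[of _ n]
    by (simp add: scaleR_add_left sum.distrib add_ac)
qed simp

lemma newton_expansion_truncated: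
  assumes "\<And>n. fdiff m u n = 0"
  shows "u n = (\<Sum>k<m. real (n choose k) *\<^sub>R fdiff k u 0)"
proof -
  have zero: "fdiff k u i = 0" if "m \<le> k" for k i
    using that by (induction k arbitrary: i rule: dec_induct) (simp_all add: assms)
  have "u n = (\<Sum>k\<le>n. real (n choose k) *\<^sub>R fdiff k u 0)"
    using newton_expansion[of u 0 n] by simp
  \<comment> \<open>Both summation ranges embed in this one: terms with k > n have zero binomials,
    terms with k \<ge> m zero differences.\<close>
  also have "\<dots> = (\<Sum>k<max (Suc n) m. real (n choose k) *\<^sub>R fdiff k u 0)"
    by (rule sum.mono_neutral_left) (auto simp: binomial_eq_0)
  also have "\<dots> = (\<Sum>k<m. real (n choose k) *\<^sub>R fdiff k u 0)"
    by (rule sum.mono_neutral_right) (auto simp: zero)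
  finally show ?thesis .
qed

lemma binomial_polynomial:
  "\<exists>p::complex poly. degree p \<le> k \<and> (\<forall>n. poly p (of_nat n) = of_nat (n choose k))"
proof (induction k)
  case 0
  show ?case by (rule exI[of _ 1]) simp
next
  case (Suc k)
  then obtain p :: "complex poly" where p: "degree p \<le> k" "\<And>n. poly p (of_nat n) = of_nat (n choose k)"
    by blast
  \<comment> \<open>The polynomial is z (z - 1) ... (z - k) / (k + 1)!, built from its predecessor
    by the factor (z - k) / (k + 1).\<close>
  have "degree (smult (1 / of_nat (Suc k)) (p * [:- of_nat k, 1:])) \<le> Suc k"
    using p(1) degree_mult_le[of p "[:- of_nat k, 1:]"] by (intro order_trans[OF degree_smult_le]) simp
  moreover have "poly (smult (1 / of_nat (Suc k)) (p * [:- of_nat k, 1:])) (of_nat n)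
      = of_nat (n choose Suc k)" for n
  proof -
    have "of_nat (Suc k) * complex_of_nat (n choose Suc k) = of_nat ((n - k) * (n choose k))"
      using binomial_absorption[of k n] binomial_absorb_comp[of n k] by (metis of_nat_mult)
    \<comment> \<open>Truncation of n - k does no harm: for n < k the binomial is zero.\<close>
    also have "\<dots> = of_nat (n choose k) * (of_nat n - of_nat k)"
      by (cases "k \<le> n") (simp_all add: of_nat_diff binomial_eq_0)
    finally have "of_nat (Suc k) * of_nat (n choose Suc k)
        = complex_of_nat (n choose k) * (of_nat n - of_nat k)" .
    then have "of_nat (n choose Suc k)
        = complex_of_nat (n choose k) * (of_nat n - of_nat k) / of_nat (Suc k)"
      by (metis nonzero_mult_div_cancel_left of_nat_eq_0_iff nat.distinct(2))
    then show ?thesis by (simp only: poly_smult poly_mult p(2)) simp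
  qed
  ultimately show ?case by blast
qed


section \<open>Weighted shifts\<close>

lift_definition ell2_single :: "nat \<Rightarrow> 'a \<Rightarrow> 'a::complex_hilbert_space ell2"
  is "\<lambda>n h i. if i = n then h else 0"
proof -
  fix n :: nat and h :: 'a
  show "summable (\<lambda>i. (norm (if i = n then h else 0))\<^sup>2)"
    by (rule summable_finite[of "{n}"]) auto
qed

lemma norm_ell2_single [simp]: "norm (ell2_single n h) = norm h"
proof -
  have "(\<Sum>i. (norm (seq_of (ell2_single n h) i))\<^sup>2) = (\<Sum>i\<in>{n}. (norm (seq_of (ell2_single n h) i))\<^sup>2)"
    by (rule suminf_finite) (auto simp: ell2_single.rep_eq)
  then show ?thesis by (simp add: norm_ell2_def ell2_single.rep_eq)
qed

lemma weighted_shift_single: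
  assumes S: "weighted_shift W S"
  shows "S (ell2_single n h) = ell2_single (Suc n) (W (Suc n) h)"
proof -
  have "seq_of (S (ell2_single n h)) i = seq_of (ell2_single (Suc n) (W (Suc n) h)) i" for i
  proof (cases i)
    case (Suc k)
    have "bounded_clinear (W (Suc k))" using S by (simp add: weighted_shift_def)
    then show ?thesis
      using S Suc by (simp add: weighted_shift_def ell2_single.rep_eq bounded_clinearD)
  qed (use S in \<open>simp add: weighted_shift_def ell2_single.rep_eq\<close>)
  then show ?thesis by (simp add: seq_of_inject[symmetric] fun_eq_iff)
qed

text \<open>Starting from \<open>weight_prod W n g\<close> makes each iterate a full product applied
  to g, so its squared norm is the form of Q (n + k) at g.\<close>

lemma weighted_shift_power_single:
  assumes S: "weighted_shift W S"
  shows "(S ^^ k) (ell2_single n (weight_prod W n g)) = ell2_single (n + k) (weight_prod W (n + k) g)"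
  by (induction k) (simp_all add: weighted_shift_single[OF S])

text \<open>The adjoint is exhibited as the backward shift with the same, self-adjoint weights. Most
  of the proof checks that it maps into square-summable sequences and is bounded by M.\<close>

lemma weighted_shift_adjoint:
  assumes S: "weighted_shift W S" and sym: "\<And>j x y. j \<ge> 1 \<Longrightarrow> cinner (W j x) y = cinner x (W j y)"
  shows "cinner (S x) y = cinner x (cadjoint S y)"
proof -
  have W: "bounded_clinear (W j)" if "j \<ge> 1" for j using S that by (simp add: weighted_shift_def)
  obtain M where M: "\<And>j. j \<ge> 1 \<Longrightarrow> onorm (W j) \<le> M" using S weighted_shift_def by metis
  have bound: "norm (W (Suc i) v) \<le> M * norm v" for i v
    by (rule order_trans[OF onorm[OF bounded_clinearD(1)[OF W]] mult_right_mono[OF M norm_ge_zero]])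
      simp_all
  have le: "(norm (W (Suc i) v))\<^sup>2 \<le> M\<^sup>2 * (norm v)\<^sup>2" for i v
    using power_mono[OF bound norm_ge_zero] by (simp add: power_mult_distrib)
  have M0: "0 \<le> M" using M[of 1] onorm_pos_le[OF bounded_clinearD(1)[OF W[of 1]]] by simp
  have shift: "summable (\<lambda>i. (norm (seq_of h (Suc i)))\<^sup>2)" for h :: "'a ell2"
    using summable_ell2[of h] by (subst summable_Suc_iff)
  have summ: "summable (\<lambda>i. (norm (W (Suc i) (seq_of h (Suc i))))\<^sup>2)" for h
    by (rule summable_comparison_test'[OF summable_mult[OF shift[of h], of "M\<^sup>2"]]) (simp add: le)
  define T where "T h = Abs_ell2 (\<lambda>i. W (Suc i) (seq_of h (Suc i)))" for h
  have T: "seq_of (T h) = (\<lambda>i. W (Suc i) (seq_of h (Suc i)))" for h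
    unfolding T_def by (rule Abs_ell2_inverse) (simp add: summ)
  have normT: "norm (T h) \<le> norm h * M" for h
  proof (rule power2_le_imp_le)
    have "(norm (T h))\<^sup>2 \<le> (\<Sum>i. M\<^sup>2 * (norm (seq_of h (Suc i)))\<^sup>2)"
      unfolding norm_ell2_sq T by (intro suminf_le le summ summable_mult shift)
    also have "\<dots> = M\<^sup>2 * (\<Sum>i. (norm (seq_of h (Suc i)))\<^sup>2)"
      by (intro suminf_mult shift)
    also have "\<dots> \<le> M\<^sup>2 * (norm h)\<^sup>2"
      unfolding norm_ell2_sq suminf_split_head[OF summable_ell2] by (intro mult_left_mono) auto
    finally show "(norm (T h))\<^sup>2 \<le> (norm h * M)\<^sup>2" by (simp add: power_mult_distrib mult.commute)
  qed (use M0 in simp)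
  have "bounded_clinear T"
    unfolding bounded_clinear_def
  proof (intro conjI allI bounded_linear_intro[OF _ _ normT])
    show "T (x + y) = T x + T y" for x y
      by (simp add: seq_of_inject[symmetric] T plus_ell2.rep_eq bounded_clinearD[OF W] fun_eq_iff)
    show "T (r *\<^sub>R x) = r *\<^sub>R T x" for r x
      by (simp add: seq_of_inject[symmetric] T scaleR_ell2.rep_eq bounded_clinearD[OF W] fun_eq_iff)
    show "T (c *\<^sub>C x) = c *\<^sub>C T x" for c x
      by (simp add: seq_of_inject[symmetric] T scaleC_ell2.rep_eq bounded_clinearD[OF W] fun_eq_iff)
  qed
  moreover have rel: "cinner (S x) y = cinner x (T y)" for x y
  proof -
    have S_seq: "seq_of (S x) 0 = 0" "seq_of (S x) (Suc i) = W (Suc i) (seq_of x i)" for i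
      using S by (auto simp: weighted_shift_def)
    have "(\<Sum>n. cinner (seq_of (S x) n) (seq_of y n)) = (\<Sum>n. cinner (seq_of (S x) (Suc n)) (seq_of y (Suc n)))"
      using suminf_split_head[OF summ_cinner[of "S x" y]] by (simp add: S_seq)
    then show ?thesis by (simp add: cinner_ell2_def S_seq T sym)
  qed
  ultimately have "cadjoint S = T" by (rule cadjoint_eqI)
  then show ?thesis using rel by simp
qed

lemma m_isometric_norm_sum:
  assumes iso: "m_isometric m S" and adj: "\<And>x y. cinner (S x) y = cinner x (cadjoint S y)"
  shows "(\<Sum>k\<le>m. (real (m choose k) * (-1) ^ (m - k)) * (norm ((S ^^ k) x))\<^sup>2) = 0"
proof -
  have "cinner ((cadjoint S ^^ k) y) x = cinner y ((S ^^ k) x)" for k x y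
  proof (induction k arbitrary: x)
    case (Suc k)
    have "cinner (cadjoint S z) x = cinner z (S x)" for z
      using adj by (metis cinner_commute)
    then show ?case using Suc by (simp add: funpow_swap1[of S])
  qed simp
  then have eq: "cinner ((cadjoint S ^^ k) ((S ^^ k) x)) x = of_real ((norm ((S ^^ k) x))\<^sup>2)" for k
    by (simp add: cinner_self)
  have "0 = cinner (\<Sum>k\<le>m. (real (m choose k) * (-1) ^ (m - k)) *\<^sub>R (cadjoint S ^^ k) ((S ^^ k) x)) x"
    using iso by (simp add: m_isometric_def)
  also have "\<dots> = of_real (\<Sum>k\<le>m. (real (m choose k) * (-1) ^ (m - k)) * (norm ((S ^^ k) x))\<^sup>2)"
    by (simp only: cinner_sum_left cinner_scaleR_left eq of_real_sum of_real_mult)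
  finally show ?thesis by (metis of_real_eq_0_iff)
qed

text \<open>For self-adjoint weights this is the adjoint of \<open>weight_prod W n\<close>; as an
  explicit product it lets commutation and bijectivity be proved factor by factor.\<close>

fun adjoint_prod :: "(nat \<Rightarrow> 'a \<Rightarrow> 'a) \<Rightarrow> nat \<Rightarrow> 'a \<Rightarrow> 'a" where
  "adjoint_prod W 0 = id"
| "adjoint_prod W (Suc n) = adjoint_prod W n \<circ> W (Suc n)"

text \<open>The operator Q n, free of \<open>cadjoint\<close> and \<open>sqrt_op\<close>;
  \<open>modulus_weight_prod_square\<close> links it to the modulus.\<close>

definition gram :: "(nat \<Rightarrow> 'a \<Rightarrow> 'a) \<Rightarrow> nat \<Rightarrow> 'a \<Rightarrow> 'a" where
  "gram W n = adjoint_prod W n \<circ> weight_prod W n"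

lemma gram_0: "gram W 0 = id"
  by (simp add: gram_def fun_eq_iff)

lemma commute_adjoint_prod:
  assumes "\<And>i. i \<in> {1..n} \<Longrightarrow> T \<circ> W i = W i \<circ> T"
  shows "T \<circ> adjoint_prod W n = adjoint_prod W n \<circ> T"
  using assms
proof (induction n)
  case (Suc n)
  show ?case
    unfolding adjoint_prod.simps by (intro commute_comp Suc.IH Suc.prems) auto
qed simp

lemma commute_gram:
  assumes "\<And>i. i \<in> {1..n} \<Longrightarrow> T \<circ> W i = W i \<circ> T"
  shows "T \<circ> gram W n = gram W n \<circ> T"
  unfolding gram_def by (intro commute_comp commute_weight_prod commute_adjoint_prod assms)

section \<open>The operators Q n for positive invertible weights\<close>

locale positive_weights =
  fixes W :: "nat \<Rightarrow> 'a::complex_hilbert_space \<Rightarrow> 'a"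
  assumes positive: "\<And>j. j \<ge> 1 \<Longrightarrow> positive_op (W j)"
    and invertible: "\<And>j. j \<ge> 1 \<Longrightarrow> invertible_op (W j)"
begin

lemma bounded_clinear_weight: "j \<ge> 1 \<Longrightarrow> bounded_clinear (W j)"
  using positive by (simp add: positive_op_def)

lemma nonneg_weight: "j \<ge> 1 \<Longrightarrow> nonneg_op (W j)"
  using positive[of j] unfolding positive_op_def nonneg_op_def
  by (metis bounded_clinearD(6) cinner_zero_left Reals_0 less_imp_le order_refl zero_complex.sel(1))

lemma selfadjoint_weight: "j \<ge> 1 \<Longrightarrow> cinner (W j x) y = cinner x (W j y)"
  using nonneg_weight[of j] by (auto simp: nonneg_op_def intro: selfadjoint_if_real)

lemma bij_weight: "j \<ge> 1 \<Longrightarrow> bij (W j)"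
  using invertible[of j] by (auto simp: invertible_op_def intro: o_bij)

lemma weight_norm_ge:
  assumes "j \<ge> 1"
  shows "\<exists>d>0. \<forall>x. d * norm x \<le> norm (W j x)"
proof -
  obtain T where T: "bounded_clinear T" "T \<circ> W j = id"
    using invertible[OF assms] by (auto simp: invertible_op_def)
  obtain K where K: "K > 0" "\<And>x. norm (T x) \<le> norm x * K"
    using bounded_linear.pos_bounded[OF bounded_clinearD(1)[OF T(1)]] by blast
  have "1 / K * norm x \<le> norm (W j x)" for x
    using K(2)[of "W j x"] K(1) fun_cong[OF T(2), of x] by (simp add: field_simps)
  then show ?thesis using K(1) by (intro exI[of _ "1 / K"]) simp
qed

text \<open>Strict positivity of the form gives no uniform bound in infinite dimension; the bounded
  inverse supplies it.\<close>

lemma coercive_weight: "j \<ge> 1 \<Longrightarrow> coercive (W j)"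
  using weight_norm_ge[of j] coercive_if_bounded_below[OF nonneg_weight] by blast

lemma bounded_clinear_weight_prod: "bounded_clinear (weight_prod W n)"
  by (induction n) (auto simp only: weight_prod.simps
      intro!: bounded_clinear_id bounded_clinear_compose bounded_clinear_weight)

lemma bounded_clinear_adjoint_prod: "bounded_clinear (adjoint_prod W n)"
  by (induction n) (auto simp only: adjoint_prod.simps
      intro!: bounded_clinear_id bounded_clinear_compose bounded_clinear_weight)

lemma bounded_clinear_gram: "bounded_clinear (gram W n)"
  unfolding gram_def
  by (intro bounded_clinear_compose bounded_clinear_adjoint_prod bounded_clinear_weight_prod)

lemma bij_weight_prod: "bij (weight_prod W n)"
  by (induction n) (auto simp only: weight_prod.simps intro!: bij_id bij_comp bij_weight)

lemma bij_adjoint_prod: "bij (adjoint_prod W n)"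
  by (induction n) (auto simp only: adjoint_prod.simps intro!: bij_id bij_comp bij_weight)

lemma cinner_weight_prod: "cinner (weight_prod W n x) y = cinner x (adjoint_prod W n y)"
  by (induction n arbitrary: y) (simp_all add: selfadjoint_weight)

lemma cinner_gram: "cinner (gram W n x) y = cinner (weight_prod W n x) (weight_prod W n y)"
  unfolding gram_def o_apply by (metis cinner_commute cinner_weight_prod)

lemma selfadjoint_gram: "cinner (gram W n x) y = cinner x (gram W n y)"
  by (metis cinner_commute cinner_gram)

lemma weight_prod_norm_ge: "\<exists>d>0. \<forall>x. d * norm x \<le> norm (weight_prod W n x)"
proof (induction n)
  case 0
  show ?case by (intro exI[of _ 1]) simp
next
  case (Suc n)
  then obtain d where d: "d > 0" "\<And>x. d * norm x \<le> norm (weight_prod W n x)" by blast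
  obtain e where e: "e > 0" "\<And>x. e * norm x \<le> norm (W (Suc n) x)"
    using weight_norm_ge[of "Suc n"] by auto
  have "e * d * norm x \<le> norm (weight_prod W (Suc n) x)" for x
    using order_trans[OF mult_left_mono[OF d(2)[of x], of e] e(2)] e(1) by (simp add: mult.assoc)
  then show ?case using d(1) e(1) by (intro exI[of _ "e * d"]) simp
qed

lemma coercive_gram: "coercive (gram W n)"
proof -
  obtain d where d: "d > 0" "\<And>x. d * norm x \<le> norm (weight_prod W n x)"
    using weight_prod_norm_ge by blast
  have "d\<^sup>2 * (norm x)\<^sup>2 \<le> Re (cinner (gram W n x) x)" for x
    using power_mono[OF d(2)[of x], of 2] d(1) by (simp add: cinner_gram Re_cinner_self power_mult_distrib)
  then show ?thesis
    unfolding coercive_def using bounded_clinear_gram d(1) by (auto intro!: exI[of _ "d\<^sup>2"])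
qed

lemma modulus_weight_prod_square: "modulus_op (weight_prod W n) ^^ 2 = gram W n"
proof -
  have "cadjoint (weight_prod W n) = adjoint_prod W n"
    by (intro cadjoint_eqI bounded_clinear_adjoint_prod cinner_weight_prod)
  then show ?thesis
    unfolding modulus_op_def by (simp only: gram_def[symmetric] sqrt_op_square[OF coercive_gram selfadjoint_gram])
qed

text \<open>Cancelling the bijections \<open>(W 1 \<circ> \<dots> \<circ> W n)\<close> and \<open>(W n \<circ> \<dots> \<circ> W 1)\<close> from the two ends of
  \<open>gram W (n + 1)\<close> shows that \<open>T\<close> commutes with the square of \<open>W (n + 1)\<close>.\<close>

lemma commute_weight_if_commute_gram:
  assumes T: "bounded_clinear T" and comm: "\<And>n. T \<circ> gram W n = gram W n \<circ> T" and "j \<ge> 1"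
  shows "T \<circ> W j = W j \<circ> T"
  using \<open>j \<ge> 1\<close>
proof (induction j rule: less_induct)
  case (less j)
  then obtain n where j: "j = Suc n" by (cases j) auto
  have P: "T (weight_prod W n x) = weight_prod W n (T x)"
    "T (adjoint_prod W n x) = adjoint_prod W n (T x)" for x
    using fun_cong[OF commute_weight_prod[of n T W], of x]
      fun_cong[OF commute_adjoint_prod[of n T W], of x] less.IH j by (simp_all add: fun_eq_iff)
  have "T (W j (W j x)) = W j (W j (T x))" for x
  proof -
    obtain y where y: "x = weight_prod W n y"
      using bij_weight_prod by (metis bij_pointE)
    have "adjoint_prod W n (T (W j (W j x))) = adjoint_prod W n (W j (W j (T x)))"
      using fun_cong[OF comm[of "Suc n"], of y] by (simp add: gram_def j y P)
    then show ?thesis using bij_adjoint_prod by (metis bij_def injD)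
  qed
  then show ?case
    by (intro commute_if_commute_square[OF coercive_weight[OF less.prems] T]) (simp add: fun_eq_iff)
qed

text \<open>The preceding lemma is used twice: T = Q n shows that every Q n commutes with every
  weight, after which T = W i is admissible.\<close>

lemma commuting_weights_if_commuting_grams:
  assumes "\<And>n k. gram W n \<circ> gram W k = gram W k \<circ> gram W n"
  shows "commuting_family {1..} W"
proof -
  have "gram W n \<circ> W j = W j \<circ> gram W n" if "j \<ge> 1" for n j
    using commute_weight_if_commute_gram[OF bounded_clinear_gram assms that] .
  then have "W i \<circ> W j = W j \<circ> W i" if "i \<ge> 1" "j \<ge> 1" for i j
    using commute_weight_if_commute_gram[OF bounded_clinear_weight[OF that(1)] _ that(2)] that(1) by metis
  then show ?thesis by (auto simp: commuting_family_def)
qed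

text \<open>Testing the \<open>m\<close>-isometry identity on the vector \<open>W n \<cdots> W 1 g\<close> placed in position \<open>n\<close>.\<close>

lemma fdiff_gram_zero:
  assumes S: "weighted_shift W S" and iso: "m_isometric m S"
  shows "fdiff m (\<lambda>i. gram W i x) n = 0"
proof -
  define G where "G x = (\<Sum>k\<le>m. (real (m choose k) * (-1) ^ (m - k)) *\<^sub>R gram W (n + k) x)" for x
  \<comment> \<open>The exponents m + k and m - k have equal parity, as k \<le> m.\<close>
  have "fdiff m (\<lambda>i. gram W i x) n = G x"
    unfolding fdiff_eq_sum G_def by (intro sum.cong) (simp_all add: minus_one_power_iff even_diff_nat)
  \<comment> \<open>The test vectors only see the quadratic form of \<open>G\<close>; symmetry of
    \<open>G\<close> turns its vanishing into \<open>G\<close> = 0.\<close>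
  also have "G x = 0"
  proof (rule zero_if_quadratic_form_zero[where T = G])
    show "bounded_clinear G"
      unfolding G_def by (intro bounded_clinear_sum bounded_clinear_scaleR bounded_clinear_gram)
    show "cinner (G x) y = cinner x (G y)" for x y
      by (simp add: G_def cinner_sum_left cinner_sum_right cinner_scaleR_left cinner_scaleR_right
          selfadjoint_gram)
    show "Re (cinner (G g) g) = 0" for g
      using m_isometric_norm_sum[OF iso weighted_shift_adjoint[OF S selfadjoint_weight],
          of "ell2_single n (weight_prod W n g)"]
      by (simp add: G_def weighted_shift_power_single[OF S] cinner_sum_left cinner_scaleR_left
          cinner_gram cinner_self flip: of_real_power of_real_mult of_real_sum)
  qed
  finally show ?thesis .
qed

text \<open>Newton's formula writes Q n through differences at 0 of order below m, and these involve
  only Q 0, ..., Q (m - 1).\<close>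

lemma commute_gram_if_commute_initial_grams:
  assumes S: "weighted_shift W S" and iso: "m_isometric m S"
    and T: "bounded_clinear T" and comm: "\<And>i. i < m \<Longrightarrow> T \<circ> gram W i = gram W i \<circ> T"
  shows "T \<circ> gram W n = gram W n \<circ> T"
proof -
  have "T (gram W i x) = gram W i (T x)" if "i < m" for i x
    using fun_cong[OF comm[OF that], of x] by simp
  then have diff: "T (fdiff k (\<lambda>i. gram W i x) 0) = fdiff k (\<lambda>i. gram W i (T x)) 0" if "k < m" for k x
    using that by (simp add: fdiff_eq_sum bounded_clinearD[OF T])
  have newton: "gram W n x = (\<Sum>k<m. real (n choose k) *\<^sub>R fdiff k (\<lambda>i. gram W i x) 0)" for x
    by (rule newton_expansion_truncated[OF fdiff_gram_zero[OF S iso]])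
  have "T (gram W n x) = gram W n (T x)" for x
    unfolding newton by (simp add: bounded_clinearD[OF T] diff)
  then show ?thesis by auto
qed

lemma gram_eq_op_poly:
  assumes S: "weighted_shift W S" and iso: "m_isometric m S" and "m \<ge> 1"
  obtains A where "\<And>j. bounded_clinear (A j)" "\<And>n. op_poly (m - 1) A (of_nat n) = gram W n"
proof -
  obtain p :: "nat \<Rightarrow> complex poly"
    where p: "\<And>k. degree (p k) \<le> k" "\<And>k n. poly (p k) (of_nat n) = of_nat (n choose k)"
    using binomial_polynomial by metis
  define D where "D k x = fdiff k (\<lambda>i. gram W i x) 0" for k x
  \<comment> \<open>Newton's formula regrouped by powers of z: A j collects the z^j coefficients of
    the binomial polynomials, weighted by the differences \<open>D k\<close>.\<close>
  define A where "A j x = (\<Sum>k<m. coeff (p k) j *\<^sub>C D k x)" for j x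
  have "bounded_clinear (D k)" for k
    unfolding D_def fdiff_eq_sum
    by (intro bounded_clinear_sum bounded_clinear_scaleR bounded_clinear_gram)
  then have "bounded_clinear (A j)" for j
    unfolding A_def by (intro bounded_clinear_sum bounded_clinear_scaleC)
  moreover have "op_poly (m - 1) A (of_nat n) = gram W n" for n
  proof
    fix x
    have poly: "(\<Sum>j\<le>m - 1. of_nat n ^ j * coeff (p k) j) = complex_of_nat (n choose k)" if "k < m" for k
    proof -
      have "complex_of_nat (n choose k) = (\<Sum>j\<le>degree (p k). of_nat n ^ j * coeff (p k) j)"
        by (simp only: p(2)[symmetric] poly_altdef mult.commute)
      also have "\<dots> = (\<Sum>j\<le>m - 1. of_nat n ^ j * coeff (p k) j)"
        using p(1)[of k] that by (intro sum.mono_neutral_left) (auto simp: coeff_eq_0)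
      finally show ?thesis by simp
    qed
    have "op_poly (m - 1) A (of_nat n) x
        = (\<Sum>j\<le>m - 1. \<Sum>k<m. (of_nat n ^ j * coeff (p k) j) *\<^sub>C D k x)"
      by (simp only: op_poly_def A_def scaleC_sum_right scaleC_scaleC)
    also have "\<dots> = (\<Sum>k<m. \<Sum>j\<le>m - 1. (of_nat n ^ j * coeff (p k) j) *\<^sub>C D k x)"
      by (rule sum.swap)
    also have "\<dots> = (\<Sum>k<m. real (n choose k) *\<^sub>R D k x)"
      by (intro sum.cong refl, simp only: scaleC_sum_left[symmetric] lessThan_iff poly)
        (simp flip: scaleC_of_real)
    also have "\<dots> = gram W n x"
      unfolding D_def using newton_expansion_truncated[OF fdiff_gram_zero[OF S iso]] by metis
    finally show "op_poly (m - 1) A (of_nat n) x = gram W n x" .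
  qed
  ultimately show thesis by (rule that)
qed

end

theorem theorem3p10:
  fixes m :: nat
    and S :: "'a::complex_hilbert_space ell2 \<Rightarrow> 'a ell2"
    and W :: "nat \<Rightarrow> 'a \<Rightarrow> 'a"
  assumes "m \<ge> 1"
    and "bounded_clinear S"
    and "weighted_shift W S"
    and "m_isometric m S"
    and "\<And>j. j \<ge> 1 \<Longrightarrow> positive_op (W j)"
    and "\<And>j. j \<ge> 1 \<Longrightarrow> invertible_op (W j)"
  shows "(commuting_family {1..} W \<longleftrightarrow> commuting_family {1..m - 1} W) \<and>
    (commuting_family {1..m - 1} W \<longleftrightarrow>
      (\<forall>A. (\<forall>j\<le>m - 1. bounded_clinear (A j)) \<and> A 0 = id \<and>
           (\<forall>n\<ge>1. op_poly (m - 1) A (of_nat n) = modulus_op (weight_prod W n) ^^ 2) \<longrightarrow>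
           commuting_family {1..m - 1} A))"
proof -
  interpret positive_weights W
    using assms(5,6) by unfold_locales
  let ?grams_commute = "\<forall>n k. gram W n \<circ> gram W k = gram W k \<circ> gram W n"
  let ?coefficients_commute = "\<forall>A. (\<forall>j\<le>m - 1. bounded_clinear (A j)) \<and> A 0 = id \<and>
    (\<forall>n\<ge>1. op_poly (m - 1) A (of_nat n) = modulus_op (weight_prod W n) ^^ 2) \<longrightarrow>
    commuting_family {1..m - 1} A"
  note extend = commute_gram_if_commute_initial_grams[OF assms(3,4)]
  have grams: "?grams_commute" if "commuting_family {1..m - 1} W"
  proof -
    \<comment> \<open>For k < m the operator Q k contains only W 1, ..., W (m - 1). If m = 1, the
      index set is empty and only Q 0 = id remains below m.\<close>
    have "W j \<circ> gram W k = gram W k \<circ> W j" if "j \<in> {1..m - 1}" "k < m" for j k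
      using that \<open>commuting_family {1..m - 1} W\<close>
      by (intro commute_gram) (auto simp: commuting_family_def)
    then have "gram W i \<circ> gram W k = gram W k \<circ> gram W i" if "i < m" "k < m" for i k
      using that by (intro commute_gram) auto
    \<comment> \<open>The bound m is lifted one index at a time: first Q i with i < m is the
      commuting operator, then an arbitrary Q n.\<close>
    then have "gram W i \<circ> gram W n = gram W n \<circ> gram W i" if "i < m" for i n
      using extend[OF bounded_clinear_gram] that by metis
    then show ?thesis
      using extend[OF bounded_clinear_gram] by metis
  qed
  have weights: "commuting_family {1..} W" if ?grams_commute
    using that by (intro commuting_weights_if_commuting_grams) blast
  have restrict: "commuting_family {1..m - 1} W" if "commuting_family {1..} W"
    using that by (auto simp: commuting_family_def)
  have coefficients: ?coefficients_commute if gc: ?grams_commute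
  proof (intro allI impI)
    fix A assume A: "(\<forall>j\<le>m - 1. bounded_clinear (A j)) \<and> A 0 = id \<and>
      (\<forall>n\<ge>1. op_poly (m - 1) A (of_nat n) = modulus_op (weight_prod W n) ^^ 2)"
    \<comment> \<open>The hypothesis starts at n = 1; the value at 0 comes from A 0 = id = Q
      0.\<close>
    have poly: "op_poly (m - 1) A (of_nat n) = gram W n" for n
    proof (cases n)
      case 0
      then show ?thesis using A by (simp only: of_nat_0 op_poly_0 gram_0)
    next
      case (Suc k)
      then show ?thesis
        using A modulus_weight_prod_square[of n] by (metis Suc_eq_plus1 le_add2)
    qed
    have comm: "gram W n \<circ> A j = A j \<circ> gram W n" if "j \<le> m - 1" for n j
      by (rule commute_coefficient[OF bounded_clinear_gram _ that]) (unfold poly, rule gc[rule_format])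
    \<comment> \<open>Second pass: by \<open>comm\<close> each A i commutes with all values of the
      polynomial, hence with its coefficients.\<close>
    have "A i \<circ> A j = A j \<circ> A i" if "i \<le> m - 1" "j \<le> m - 1" for i j
    proof (rule commute_coefficient[OF _ _ that(2)])
      show "bounded_clinear (A i)" using A that(1) by blast
      show "A i \<circ> op_poly (m - 1) A (of_nat k) = op_poly (m - 1) A (of_nat k) \<circ> A i" for k
        unfolding poly by (rule comm[OF that(1), symmetric])
    qed
    then show "commuting_family {1..m - 1} A"
      by (simp add: commuting_family_def)
  qed
  have "?grams_commute" if cc: ?coefficients_commute
  proof -
    obtain A where A: "\<And>j. bounded_clinear (A j)" "\<And>n. op_poly (m - 1) A (of_nat n) = gram W n"
      using gram_eq_op_poly[OF assms(3,4,1)] by blast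
    have A0: "A 0 = id"
      using A(2)[of 0] by (simp add: op_poly_0 gram_0)
    have "commuting_family {1..m - 1} A"
      by (rule cc[rule_format]) (simp only: A A0 modulus_weight_prod_square simp_thms)
    \<comment> \<open>The family starts at index 1; index 0 is added because A 0 is the
      identity.\<close>
    then have comm: "A i \<circ> A j = A j \<circ> A i" if "i \<le> m - 1" "j \<le> m - 1" for i j
      using that A0 by (cases "i = 0 \<or> j = 0") (auto simp: commuting_family_def)
    have "A j \<circ> gram W n = gram W n \<circ> A j" if "j \<le> m - 1" for j n
      unfolding A(2)[symmetric] using comm that by (intro commute_op_poly A(1)) auto
    then have "gram W k \<circ> gram W n = gram W n \<circ> gram W k" for n k
      using commute_op_poly[OF bounded_clinear_gram, where n = "m - 1" and A = A and z = "of_nat n"]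
      by (metis A(2))
    then show ?thesis by blast
  qed
  then show ?thesis
    using grams weights restrict coefficients by blast
qed

end
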